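(* Let $X$ be a complete separable metric space with a $\sigma$-finite reference (Borel) measure $\mu$, let $\psi_n$, $n\ge0$, be an orthonormal family of complex-valued functions in $L^2(X,\mu)$, and let $a_n\ge0$, $n\ge 0$, satisfy $\sum_{n=0}^\infty a_n<\infty$. Set $$\phi(x,y)=\sum_{n=0}^\infty a_n\psi_n(x)\overline{\psi_n(y)},$$ $Z_0=1$, $Z_N=\int_{X^N}\det(\phi(x_i,x_j))_{1\le i,j\le N}\,d^N\mu(x)$ for $N\geq 1$, and assume that $Z_N>0$ and $p_N(x)=\frac1{Z_N}\det(\phi(x_i,x_j))_{1\le i,j\le N}\ge0$. Let $\lambda>0$ and $Z(\lambda)=\sum_{N=0}^\infty\frac{\lambda^N}{N!}Z_N$. Consider the (grand canonical) point process on $X$ which has exactly $N$ particles with probability $q_N=\frac{\lambda^N}{N!}\frac{Z_N}{Z(\lambda)}$ and for which, given that there are exactly $N$ particles, their positions $x_1,\dots,x_N$ have the distribution $p_N(x)\,d^N\mu(x)$ on $X^N$. Then this point process is a determinantal process on $X$ with correlation kernel $$K_\lambda(x,y)=\sum_{n=0}^\infty\frac{\lambda a_n}{1+\lambda a_n}\psi_n(x)\overline{\psi_n(y)} .$$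
   Context: The series for $\phi(x,y)$ converges in $L^2(\mu\times\mu)$, and $\phi(x,x)=\sum_n a_n|\psi_n(x)|^2$ is well-defined in $L^1(\mu)$; the diagonal entries in the determinants are understood in this sense (equivalently, the series converge absolutely for $x,y$ outside a $\mu$-null set). The same applies to $K_\lambda$. $d^N\mu$ denotes the product measure $\mu^{\otimes N}$. A point process on $X$ is determinantal with correlation kernel $K$ (with respect to $\mu$) if its correlation functions are $\rho_k(x_1,\dots,x_k)=\det(K(x_i,x_j))_{1\le i,j\le k}$, i.e. for every bounded measurable $g$ on $X$ with bounded support, $\mathbb{E}[\prod_j(1+g(x_j))]=\sum_{k=0}^\infty\frac1{k!}\int_{X^k}\prod_{j=1}^kg(x_j)\det(K(x_i,x_j))_{1\le i,j\le k}\,d^k\mu(x)$, the product on the left being over all particles in the process. *)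

theory Defs
  imports
    "HOL-Probability.Probability"
    "HOL-Library.Complex_Order"
    "Jordan_Normal_Form.Determinant"
begin

section \<open>Kernels\<close>

definition orthonormal_L2 :: "'a measure \<Rightarrow> (nat \<Rightarrow> 'a \<Rightarrow> complex) \<Rightarrow> bool" where
  "orthonormal_L2 M \<psi> \<longleftrightarrow>
     (\<forall>n. \<psi> n \<in> borel_measurable M \<and> integrable M (\<lambda>x. (cmod (\<psi> n x))\<^sup>2)) \<and>
     (\<forall>m n. (\<integral>x. \<psi> m x * cnj (\<psi> n x) \<partial>M) = (if m = n then 1 else 0))"

text \<open>For an orthonormal family and summable nonnegative coefficients the series converges
  absolutely for all x, y outside a null set. On the exceptional set the value of the
  infinite sum is irrelevant, since kernels only enter through integrals.\<close>

definition series_kernel ::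
    "(nat \<Rightarrow> real) \<Rightarrow> (nat \<Rightarrow> 'a \<Rightarrow> complex) \<Rightarrow> 'a \<Rightarrow> 'a \<Rightarrow> complex" where
  "series_kernel c \<psi> x y = (\<Sum>n. complex_of_real (c n) * \<psi> n x * cnj (\<psi> n y))"

definition kernel_det :: "('a \<Rightarrow> 'a \<Rightarrow> complex) \<Rightarrow> nat \<Rightarrow> (nat \<Rightarrow> 'a) \<Rightarrow> complex" where
  "kernel_det K N x = Determinant.det (Matrix.mat N N (\<lambda>(i, j). K (x i) (x j)))"

text \<open>The \<open>N\<close>-fold product measure; points of the \<open>N\<close>-fold product are
  functions on \<open>{..<N}\<close>.\<close>

abbreviation power_measure :: "'a measure \<Rightarrow> nat \<Rightarrow> (nat \<Rightarrow> 'a) measure" where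
  "power_measure M N \<equiv> (\<Pi>\<^sub>M i\<in>{..<N}. M)"

section \<open>Point processes\<close>

text \<open>A configuration is a locally finite family of particles, encoded by its multiplicity
  function: \<open>c x\<close> is the number of particles at \<open>x\<close>.\<close>

definition configs :: "('a::metric_space \<Rightarrow> nat) set" where
  "configs = {c. \<forall>B. bounded B \<longrightarrow> finite {x \<in> B. c x \<noteq> 0}}"

definition particle_count :: "('a \<Rightarrow> nat) \<Rightarrow> 'a set \<Rightarrow> nat" where
  "particle_count c B = (\<Sum>x | x \<in> B \<and> c x \<noteq> 0. c x)"

definition config_space :: "('a::metric_space \<Rightarrow> nat) measure" where
  "config_space = sigma configs
     {{c \<in> configs. particle_count c B = k} | B k. B \<in> sets borel \<and> bounded B}"

text \<open>Point processes are represented by their laws.\<close>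

definition point_process :: "('a::metric_space \<Rightarrow> nat) measure \<Rightarrow> bool" where
  "point_process P \<longleftrightarrow> prob_space P \<and> sets P = sets config_space"

text \<open>The product of \<open>1 + g x\<close> over all particles, counted with multiplicity. Particles
  with \<open>g x = 0\<close> contribute the factor 1 and are left out, so that the product is finite
  when \<open>g\<close> has bounded support.\<close>

definition particle_prod :: "('a \<Rightarrow> complex) \<Rightarrow> ('a \<Rightarrow> nat) \<Rightarrow> complex" where
  "particle_prod g c = (\<Prod>x | c x \<noteq> 0 \<and> g x \<noteq> 0. (1 + g x) ^ c x)"

text \<open>All integrals and the series are required to exist, because the Bochner integral of
  a non-integrable function is 0 by convention.\<close>

definition determinantal_process ::
    "'a::metric_space measure \<Rightarrow> ('a \<Rightarrow> 'a \<Rightarrow> complex) \<Rightarrow> ('a \<Rightarrow> nat) measure \<Rightarrow> bool" where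
  "determinantal_process M K P \<longleftrightarrow> point_process P \<and>
     (\<forall>g \<in> borel_measurable borel. bounded (range g) \<and> bounded {x. g x \<noteq> 0} \<longrightarrow>
        integrable P (particle_prod g) \<and>
        (\<forall>k. integrable (power_measure M k) (\<lambda>x. (\<Prod>j<k. g (x j)) * kernel_det K k x)) \<and>
        (\<lambda>k. 1 / fact k * (\<integral>x. (\<Prod>j<k. g (x j)) * kernel_det K k x \<partial>power_measure M k))
          sums (\<integral>c. particle_prod g c \<partial>P))"

section \<open>The grand canonical process\<close>

text \<open>Positivity of complex quantities is expressed by the order of the library theory
  of the ordered complex numbers: \<open>0 \<le> z\<close> says that \<open>z\<close> is real and nonnegative.\<close>

definition partition_fn :: "'a measure \<Rightarrow> ('a \<Rightarrow> 'a \<Rightarrow> complex) \<Rightarrow> nat \<Rightarrow> complex" where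
  "partition_fn M \<phi> N =
     (if N = 0 then 1 else \<integral>x. kernel_det \<phi> N x \<partial>power_measure M N)"

definition canonical_density ::
    "'a measure \<Rightarrow> ('a \<Rightarrow> 'a \<Rightarrow> complex) \<Rightarrow> nat \<Rightarrow> (nat \<Rightarrow> 'a) \<Rightarrow> complex" where
  "canonical_density M \<phi> N x = 1 / partition_fn M \<phi> N * kernel_det \<phi> N x"

definition grand_partition_fn ::
    "'a measure \<Rightarrow> ('a \<Rightarrow> 'a \<Rightarrow> complex) \<Rightarrow> real \<Rightarrow> complex" where
  "grand_partition_fn M \<phi> lam =
     (\<Sum>N. complex_of_real lam ^ N / fact N * partition_fn M \<phi> N)"

definition number_prob ::
    "'a measure \<Rightarrow> ('a \<Rightarrow> 'a \<Rightarrow> complex) \<Rightarrow> real \<Rightarrow> nat \<Rightarrow> complex" where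
  "number_prob M \<phi> lam N =
     complex_of_real lam ^ N / fact N * (partition_fn M \<phi> N / grand_partition_fn M \<phi> lam)"

definition config_of :: "nat \<Rightarrow> (nat \<Rightarrow> 'a) \<Rightarrow> 'a \<Rightarrow> nat" where
  "config_of N x = (\<lambda>y. card {i. i < N \<and> x i = y})"

definition canonical_process ::
    "'a::metric_space measure \<Rightarrow> ('a \<Rightarrow> 'a \<Rightarrow> complex) \<Rightarrow> nat \<Rightarrow> ('a \<Rightarrow> nat) measure" where
  "canonical_process M \<phi> N =
     distr (density (power_measure M N) (\<lambda>x. ennreal (Re (canonical_density M \<phi> N x))))
       config_space (config_of N)"

text \<open>First the number of particles \<open>N\<close> is drawn with probabilities
  \<open>number_prob M \<phi> lam N\<close>; given \<open>N\<close>, the positions are drawn from the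
  canonical density.\<close>

definition grand_canonical_process ::
    "'a::metric_space measure \<Rightarrow> ('a \<Rightarrow> 'a \<Rightarrow> complex) \<Rightarrow> real \<Rightarrow> ('a \<Rightarrow> nat) measure" where
  "grand_canonical_process M \<phi> lam =
     density (count_space UNIV) (\<lambda>N. ennreal (Re (number_prob M \<phi> lam N)))
       \<bind> canonical_process M \<phi>"

end

theory Submission
  imports Defs
begin

text \<open>Truncating the kernel to rank \<open>m\<close> makes everything finite dimensional. By Andreief's
  identity, for bounded \<open>h\<close> the sum over \<open>N\<close> of \<open>1/N!\<close> times the integral of
  \<open>h(x_1) ... h(x_N) det (\<phi>_m(x_i, x_j))\<close> is a sum of principal minors, namely \<open>det (1 + A H)\<close>
  with \<open>A = diag(a_i)\<close> and \<open>H_ij = \<integral> h \<psi>_i cnj \<psi>_j\<close>. For \<open>h = lam (1 + g)\<close> orthonormality gives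
  \<open>1 + lam A (1 + G)\<close>, and dividing row \<open>i\<close> by \<open>1 + lam a_i\<close> leaves \<open>1 + D G\<close>, where \<open>D\<close> is the
  diagonal matrix of the coefficients of the correlation kernel; the product of the factors
  \<open>1 + lam a_i\<close> is the same expression for \<open>g = 0\<close>, that is, the partition function.
  In the limit \<open>m \<rightarrow> \<infinity>\<close> each term converges by dominated convergence, and since the truncated
  determinants are nonnegative, the \<open>N\<close>-th term is at most \<open>(sup |h| \<cdot> \<Sum> a_n)^N / N!\<close>, so that
  Tannery's theorem applies to the sum over \<open>N\<close>.\<close>

section \<open>Determinants over finite index sets\<close>

definition leibniz_det :: "'i set \<Rightarrow> ('i \<Rightarrow> 'i \<Rightarrow> 'b::comm_ring_1) \<Rightarrow> 'b" where
  "leibniz_det S B = (\<Sum>p | p permutes S. of_int (sign p) * (\<Prod>i\<in>S. B i (p i)))"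

lemma leibniz_det_cong:
  assumes "\<And>i j. i \<in> S \<Longrightarrow> j \<in> S \<Longrightarrow> A i j = B i j"
  shows "leibniz_det S A = leibniz_det S B"
  unfolding leibniz_det_def
  by (intro sum.cong refl arg_cong2[where f="(*)"] prod.cong assms)
     (auto simp: permutes_in_image)

lemma kernel_det_eq_leibniz_det:
  "kernel_det K N x = leibniz_det {..<N} (\<lambda>i j. K (x i) (x j))"
  unfolding kernel_det_def Determinant.det_def leibniz_det_def
  by (auto simp: atLeast0LessThan permutes_in_image intro!: sum.cong prod.cong)

lemma leibniz_det_inverse:
  assumes "finite S"
  shows "leibniz_det S B = (\<Sum>p | p permutes S. of_int (sign p) * (\<Prod>i\<in>S. B i (inv_into UNIV p i)))"
proof -
  have "leibniz_det S B = (\<Sum>p | p permutes S. of_int (sign (inv_into UNIV p)) * (\<Prod>i\<in>S. B i (inv_into UNIV p i)))"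
    unfolding leibniz_det_def by (rule sum_permutations_inverse)
  also have "\<dots> = (\<Sum>p | p permutes S. of_int (sign p) * (\<Prod>i\<in>S. B i (inv_into UNIV p i)))"
    using assms by (intro sum.cong) (auto simp: sign_inverse permutes_imp_permutation)
  finally show ?thesis .
qed

lemma prod_inverse_permutation:
  assumes "p permutes S"
  shows "(\<Prod>i\<in>S. B i (inv_into UNIV p i)) = (\<Prod>i\<in>S. B (p i) i)"
proof -
  have "(\<Prod>i\<in>S. B (p i) i) = (\<Prod>i\<in>S. B (p i) (inv_into UNIV p (p i)))"
    using permutes_inverses(2)[OF assms] by simp
  also have "\<dots> = (\<Prod>i\<in>S. B i (inv_into UNIV p i))"
    using prod.permute[OF assms, of "\<lambda>i. B i (inv_into UNIV p i)"] by (simp add: o_def)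
  finally show ?thesis by simp
qed

lemma leibniz_det_transpose:
  assumes "finite S"
  shows "leibniz_det S (\<lambda>i j. B j i) = leibniz_det S B"
  by (simp add: leibniz_det_inverse[OF assms, of B] prod_inverse_permutation[of _ S B] leibniz_det_def[of S "\<lambda>i j. B j i"])

lemma leibniz_det_permute_rows:
  assumes fin: "finite S" and t: "t permutes S"
  shows "leibniz_det S (\<lambda>i j. B (t i) j) = of_int (sign t) * leibniz_det S B"
proof -
  have "leibniz_det S B = (\<Sum>p | p permutes S. of_int (sign (p \<circ> inv_into UNIV t)) *
      (\<Prod>i\<in>S. B i ((p \<circ> inv_into UNIV t) i)))"
    unfolding leibniz_det_def
    by (rule sum_permutations_compose_right[OF permutes_inv[OF t]])
  also have "\<dots> = (\<Sum>p | p permutes S. of_int (sign t) * (of_int (sign p) *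
      (\<Prod>i\<in>S. B (t i) (p i))))"
  proof (intro sum.cong refl)
    fix p assume p: "p \<in> {p. p permutes S}"
    have "sign (p \<circ> inv_into UNIV t) = sign p * sign t"
      using p t fin by (subst sign_compose) (auto simp: sign_inverse permutes_imp_permutation permutes_inv)
    moreover have "(\<Prod>i\<in>S. B i ((p \<circ> inv_into UNIV t) i)) = (\<Prod>i\<in>S. B (t i) (p i))"
      using prod_inverse_permutation[OF t, of "\<lambda>i j. B i (p j)"] by simp
    ultimately show "of_int (sign (p \<circ> inv_into UNIV t)) * (\<Prod>i\<in>S. B i ((p \<circ> inv_into UNIV t) i)) =
        of_int (sign t) * (of_int (sign p) * (\<Prod>i\<in>S. B (t i) (p i)))"
      by (simp add: mult_ac)
  qed
  also have "\<dots> = of_int (sign t) * leibniz_det S (\<lambda>i j. B (t i) j)"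
    by (simp add: leibniz_det_def sum_distrib_left)
  finally have "of_int (sign t) * leibniz_det S B =
      of_int (sign t * sign t) * leibniz_det S (\<lambda>i j. B (t i) j)"
    by (simp only: of_int_mult mult.assoc)
  then show ?thesis by simp
qed

lemma leibniz_det_repeated_index:
  fixes B :: "'k \<Rightarrow> 'i \<Rightarrow> 'b::{idom, ring_char_0}"
  assumes fin: "finite S" and "\<not> inj_on s S"
  shows "leibniz_det S (\<lambda>i j. B (s i) j) = 0"
proof -
  obtain k l where kl: "k \<in> S" "l \<in> S" "k \<noteq> l" "s k = s l"
    using assms(2) by (auto simp: inj_on_def)
  let ?t = "Transposition.transpose k l"
  have t: "?t permutes S" using kl by (intro permutes_swap_id) auto
  have st: "s (?t i) = s i" for i
    using kl by (auto simp: Transposition.transpose_def)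
  have "leibniz_det S (\<lambda>i j. B (s i) j) = - leibniz_det S (\<lambda>i j. B (s i) j)"
    using leibniz_det_permute_rows[OF fin t, of "\<lambda>i. B (s i)"] kl by (simp add: st sign_swap_id)
  then show ?thesis by simp
qed

lemma leibniz_det_reindex:
  assumes fin: "finite T" and s: "bij_betw s T S"
  shows "leibniz_det T (\<lambda>i j. B (s i) (s j)) = leibniz_det S B"
proof -
  have inj: "inj_on s T" and img: "s ` T = S" using s by (auto simp: bij_betw_def)
  have bij: "bij_betw (map_permutation T s) {p. p permutes T} {p. p permutes S}"
  proof (rule bij_betw_byWitness[where f' = "map_permutation S (inv_into T s)"])
    show "\<forall>p\<in>{p. p permutes T}. map_permutation S (inv_into T s) (map_permutation T s p) = p"
      using inj by (auto intro!: map_permutation_compose_inv[OF s])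
    show "\<forall>p\<in>{p. p permutes S}. map_permutation T s (map_permutation S (inv_into T s) p) = p"
      using f_inv_into_f[of _ s T] img
      by (intro ballI map_permutation_compose_inv[OF bij_betw_inv_into[OF s]]) auto
    show "map_permutation T s ` {p. p permutes T} \<subseteq> {p. p permutes S}"
      using map_permutation_permutes[OF s] by auto
    show "map_permutation S (inv_into T s) ` {p. p permutes S} \<subseteq> {p. p permutes T}"
      using map_permutation_permutes[OF bij_betw_inv_into[OF s]] by auto
  qed
  have "leibniz_det S B = (\<Sum>p | p permutes T. of_int (sign (map_permutation T s p)) *
      (\<Prod>i\<in>S. B i (map_permutation T s p i)))"
    unfolding leibniz_det_def by (rule sum.reindex_bij_betw[OF bij, symmetric])
  also have "\<dots> = leibniz_det T (\<lambda>i j. B (s i) (s j))"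
    unfolding leibniz_det_def
  proof (intro sum.cong refl arg_cong2[where f="(*)"] arg_cong[where f=of_int])
    fix p assume p: "p \<in> {p. p permutes T}"
    show "sign (map_permutation T s p) = sign p"
      using p fin inj by (intro sign_map_permutation) auto
    show "(\<Prod>i\<in>S. B i (map_permutation T s p i)) = (\<Prod>i\<in>T. B (s i) (s (p i)))"
      using inj by (subst prod.reindex_bij_betw[OF s, symmetric])
        (auto intro!: prod.cong simp: map_permutation_apply)
  qed
  finally show ?thesis by simp
qed

lemma leibniz_det_scale_rows:
  "leibniz_det S (\<lambda>i j. d i * B i j) = (\<Prod>i\<in>S. d i) * leibniz_det S B"
  by (simp add: leibniz_det_def prod.distrib sum_distrib_left mult_ac)

lemma leibniz_det_one_plus:
  fixes B :: "'i \<Rightarrow> 'i \<Rightarrow> 'b::comm_ring_1"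
  assumes fin: "finite S"
  shows "leibniz_det S (\<lambda>i j. (if i = j then 1 else 0) + B i j) = (\<Sum>T\<in>Pow S. leibniz_det T B)"
proof -
  let ?d = "\<lambda>i j. if i = j then 1 else 0 :: 'b"
  have "leibniz_det S (\<lambda>i j. ?d i j + B i j) = (\<Sum>p | p permutes S. \<Sum>T\<in>Pow S.
      of_int (sign p) * ((\<Prod>i\<in>T. B i (p i)) * (\<Prod>i\<in>S - T. ?d i (p i))))"
    unfolding leibniz_det_def
    by (subst add.commute, subst prod_add[OF fin]) (simp add: sum_distrib_left)
  also have "\<dots> = (\<Sum>T\<in>Pow S. \<Sum>p | p permutes S.
      of_int (sign p) * ((\<Prod>i\<in>T. B i (p i)) * (\<Prod>i\<in>S - T. ?d i (p i))))"
    by (rule sum.swap)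
  also have "\<dots> = (\<Sum>T\<in>Pow S. leibniz_det T B)"
  proof (intro sum.cong refl)
    fix T assume T: "T \<in> Pow S"
    have "(\<Sum>p | p permutes S. of_int (sign p) * ((\<Prod>i\<in>T. B i (p i)) * (\<Prod>i\<in>S - T. ?d i (p i))))
        = (\<Sum>p | p permutes T. of_int (sign p) * ((\<Prod>i\<in>T. B i (p i)) * (\<Prod>i\<in>S - T. ?d i (p i))))"
    proof (intro sum.mono_neutral_right ballI)
      show "finite {p. p permutes S}" using fin by (rule finite_permutations)
      show "{p. p permutes T} \<subseteq> {p. p permutes S}" using T by (auto intro: permutes_subset)
      fix p assume p: "p \<in> {p. p permutes S} - {p. p permutes T}"
      then obtain i where "i \<in> S - T" "p i \<noteq> i"
        using permutes_superset[of p S T] by auto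
      then have "(\<Prod>i\<in>S - T. ?d i (p i)) = 0"
        using fin by (intro prod_zero) (auto intro!: bexI[of _ i])
      then show "of_int (sign p) * ((\<Prod>i\<in>T. B i (p i)) * (\<Prod>i\<in>S - T. ?d i (p i))) = 0"
        by simp
    qed
    also have "\<dots> = leibniz_det T B"
      unfolding leibniz_det_def
      by (intro sum.cong refl) (auto simp: permutes_not_in intro!: prod.neutral)
    finally show "(\<Sum>p | p permutes S. of_int (sign p) * ((\<Prod>i\<in>T. B i (p i)) *
        (\<Prod>i\<in>S - T. ?d i (p i)))) = leibniz_det T B" .
  qed
  finally show ?thesis .
qed

lemma card_bijections_PiE:
  assumes "finite U" "card U = N"
  shows "card {s \<in> {..<N::nat} \<rightarrow>\<^sub>E U. inj_on s {..<N}} = fact N"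
  using card_inj_on_subset_funcset[OF finite_lessThan[of N] assms(1) order_refl] assms(2)
  by (simp add: fact_prod_rev)

lemma sum_leibniz_det_functions:
  fixes B :: "'k \<Rightarrow> 'k \<Rightarrow> 'b::{idom, ring_char_0}"
  assumes fin: "finite S"
  shows "(\<Sum>s\<in>{..<N} \<rightarrow>\<^sub>E S. leibniz_det {..<N} (\<lambda>i j. B (s i) (s j))) =
    fact N * (\<Sum>T | T \<subseteq> S \<and> card T = N. leibniz_det T B)"
proof -
  let ?F = "\<lambda>s. leibniz_det {..<N} (\<lambda>i j. B (s i) (s j))"
  let ?I = "{s \<in> {..<N} \<rightarrow>\<^sub>E S. inj_on s {..<N}}"
  let ?J = "{T. T \<subseteq> S \<and> card T = N}"
  have finP: "finite ({..<N} \<rightarrow>\<^sub>E S)" using fin by (intro finite_PiE) auto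
  have "?F s = 0" if "\<not> inj_on s {..<N}" for s
    using leibniz_det_repeated_index[OF finite_lessThan that, of "\<lambda>k j. B k (s j)"] by simp
  then have "(\<Sum>s\<in>{..<N} \<rightarrow>\<^sub>E S. ?F s) = (\<Sum>s\<in>?I. ?F s)"
    by (intro sum.mono_neutral_right finP) auto
  also have "\<dots> = (\<Sum>T\<in>?J. \<Sum>s\<in>{s\<in>?I. s ` {..<N} = T}. ?F s)"
  proof (rule sum.group[symmetric])
    show "finite ?I" by (rule finite_subset[OF _ finP]) auto
    show "finite ?J" using fin by simp
    show "(\<lambda>s. s ` {..<N}) ` ?I \<subseteq> ?J"
    proof (rule image_subsetI)
      fix s assume "s \<in> ?I"
      then have "inj_on s {..<N}" "s ` {..<N} \<subseteq> S" by blast+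
      then show "s ` {..<N} \<in> ?J" by (simp add: card_image)
    qed
  qed
  also have "\<dots> = (\<Sum>T\<in>?J. fact N * leibniz_det T B)"
  proof (intro sum.cong refl)
    fix T assume T: "T \<in> ?J"
    have eq: "{s\<in>?I. s ` {..<N} = T} = {s \<in> {..<N} \<rightarrow>\<^sub>E T. inj_on s {..<N}}"
      (is "?L = ?R")
    proof (rule subset_antisym; rule subsetI)
      fix s assume "s \<in> ?L" then show "s \<in> ?R" by (simp add: PiE_iff) blast
    next
      fix s assume s: "s \<in> ?R"
      then have "s ` {..<N} \<subseteq> T" "card (s ` {..<N}) = card T"
        using T by (auto simp: card_image)
      then have "s ` {..<N} = T"
        using T fin by (intro card_subset_eq) (auto intro: finite_subset)
      then show "s \<in> ?L" using s T by (simp add: PiE_iff) blast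
    qed
    have "?F s = leibniz_det T B" if "s \<in> {s\<in>?I. s ` {..<N} = T}" for s
      using that by (intro leibniz_det_reindex) (auto simp: bij_betw_def)
    then have "(\<Sum>s\<in>{s\<in>?I. s ` {..<N} = T}. ?F s) =
        of_nat (card {s\<in>?I. s ` {..<N} = T}) * leibniz_det T B"
      by simp
    also have "\<dots> = fact N * leibniz_det T B"
      unfolding eq using T fin by (subst card_bijections_PiE) (auto intro: finite_subset)
    finally show "(\<Sum>s\<in>{s\<in>?I. s ` {..<N} = T}. ?F s) = fact N * leibniz_det T B" .
  qed
  finally show ?thesis by (simp add: sum_distrib_left)
qed

lemma leibniz_det_sum_expand:
  fixes u v :: "'n \<Rightarrow> 'i \<Rightarrow> 'b::comm_ring_1"
  assumes fin: "finite S" "finite I"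
  shows "leibniz_det S (\<lambda>i j. \<Sum>n\<in>I. u n i * v n j) =
    (\<Sum>s\<in>S \<rightarrow>\<^sub>E I. (\<Prod>i\<in>S. u (s i) i) * leibniz_det S (\<lambda>i j. v (s i) j))"
proof -
  have "leibniz_det S (\<lambda>i j. \<Sum>n\<in>I. u n i * v n j) =
      (\<Sum>p | p permutes S. \<Sum>s\<in>S \<rightarrow>\<^sub>E I. of_int (sign p) * (\<Prod>i\<in>S. u (s i) i * v (s i) (p i)))"
    unfolding leibniz_det_def using fin by (subst prod_sum_PiE) (auto simp: sum_distrib_left)
  also have "\<dots> = (\<Sum>s\<in>S \<rightarrow>\<^sub>E I. \<Sum>p | p permutes S. of_int (sign p) * (\<Prod>i\<in>S. u (s i) i * v (s i) (p i)))"
    by (rule sum.swap)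
  also have "\<dots> = (\<Sum>s\<in>S \<rightarrow>\<^sub>E I. (\<Prod>i\<in>S. u (s i) i) * leibniz_det S (\<lambda>i j. v (s i) j))"
    unfolding leibniz_det_def by (simp add: prod.distrib sum_distrib_left mult_ac)
  finally show ?thesis .
qed

lemma leibniz_det_cnj: "leibniz_det S (\<lambda>i j. cnj (B i j)) = cnj (leibniz_det S B)"
  by (simp add: leibniz_det_def)

lemma bij_betw_compose_permutation:
  assumes t: "t permutes S"
  shows "bij_betw (\<lambda>s. s \<circ> t) (S \<rightarrow>\<^sub>E I) (S \<rightarrow>\<^sub>E I)"
proof (rule bij_betw_byWitness[where f' = "\<lambda>s. s \<circ> inv_into UNIV t"])
  have mem: "s \<circ> p \<in> S \<rightarrow>\<^sub>E I" if "p permutes S" "s \<in> S \<rightarrow>\<^sub>E I" for s p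
    using that by (auto simp: PiE_iff extensional_def permutes_in_image)
  show "(\<lambda>s. s \<circ> t) ` (S \<rightarrow>\<^sub>E I) \<subseteq> S \<rightarrow>\<^sub>E I" using mem[OF t] by auto
  show "(\<lambda>s. s \<circ> inv_into UNIV t) ` (S \<rightarrow>\<^sub>E I) \<subseteq> S \<rightarrow>\<^sub>E I" using mem[OF permutes_inv[OF t]] by auto
qed (auto simp: o_assoc[symmetric] permutes_inv_o[OF t])

lemma complex_of_real_nonneg: "0 \<le> r \<Longrightarrow> 0 \<le> complex_of_real r"
  by (simp add: less_eq_complex_def)

text \<open>Averaging the expansion over all relabellings \<open>s \<circ> t\<close> turns the determinant of a weighted
  Gram matrix into a sum of squared moduli, as in the Cauchy--Binet formula.\<close>

lemma leibniz_det_gram_nonneg: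
  fixes u :: "'n \<Rightarrow> 'i \<Rightarrow> complex" and c :: "'n \<Rightarrow> real"
  assumes fin: "finite S" "finite I" and c: "\<And>n. n \<in> I \<Longrightarrow> c n \<ge> 0"
  shows "0 \<le> leibniz_det S (\<lambda>i j. \<Sum>n\<in>I. complex_of_real (c n) * u n i * cnj (u n j))"
proof -
  let ?X = "leibniz_det S (\<lambda>i j. \<Sum>n\<in>I. complex_of_real (c n) * u n i * cnj (u n j))"
  let ?D = "\<lambda>s. leibniz_det S (\<lambda>i j. u (s i) j)"
  let ?w = "\<lambda>s. \<Prod>i\<in>S. c (s i)"
  have X: "?X = (\<Sum>s\<in>S \<rightarrow>\<^sub>E I. complex_of_real (?w s) * (\<Prod>i\<in>S. u (s i) i) * cnj (?D s))"
    using leibniz_det_sum_expand[OF fin, of "\<lambda>n i. complex_of_real (c n) * u n i" "\<lambda>n j. cnj (u n j)"]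
    by (simp add: leibniz_det_cnj prod.distrib)
  have "of_nat (card {t. t permutes S}) * ?X = (\<Sum>t | t permutes S. \<Sum>s\<in>S \<rightarrow>\<^sub>E I.
      complex_of_real (?w (s \<circ> t)) * (\<Prod>i\<in>S. u ((s \<circ> t) i) i) * cnj (?D (s \<circ> t)))"
  proof -
    have "(\<Sum>s\<in>S \<rightarrow>\<^sub>E I. complex_of_real (?w (s \<circ> t)) * (\<Prod>i\<in>S. u ((s \<circ> t) i) i) *
        cnj (?D (s \<circ> t))) = ?X" if "t permutes S" for t
      unfolding X by (rule sum.reindex_bij_betw[OF bij_betw_compose_permutation[OF that]])
    then show ?thesis by simp
  qed
  also have "\<dots> = (\<Sum>t | t permutes S. \<Sum>s\<in>S \<rightarrow>\<^sub>E I.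
      complex_of_real (?w s) * (of_int (sign t) * (\<Prod>i\<in>S. u (s (t i)) i)) * cnj (?D s))"
  proof (intro sum.cong refl)
    fix t s assume t: "t \<in> {t. t permutes S}"
    have "?w (s \<circ> t) = ?w s"
      using t prod.permute[of t S "\<lambda>i. c (s i)"] by (simp add: o_def)
    moreover have "?D (s \<circ> t) = of_int (sign t) * ?D s"
      using leibniz_det_permute_rows[OF fin(1), of t "\<lambda>i. u (s i)"] t by simp
    ultimately show "complex_of_real (?w (s \<circ> t)) * (\<Prod>i\<in>S. u ((s \<circ> t) i) i) * cnj (?D (s \<circ> t)) =
        complex_of_real (?w s) * (of_int (sign t) * (\<Prod>i\<in>S. u (s (t i)) i)) * cnj (?D s)"
      by (simp add: mult_ac)
  qed
  also have "\<dots> = (\<Sum>s\<in>S \<rightarrow>\<^sub>E I. \<Sum>t | t permutes S.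
      complex_of_real (?w s) * (of_int (sign t) * (\<Prod>i\<in>S. u (s (t i)) i)) * cnj (?D s))"
    by (rule sum.swap)
  also have "\<dots> = (\<Sum>s\<in>S \<rightarrow>\<^sub>E I. complex_of_real (?w s) *
      leibniz_det S (\<lambda>i j. u (s j) i) * cnj (?D s))"
    unfolding leibniz_det_def[of S "\<lambda>i j. u (s j) i" for s]
    by (simp only: sum_distrib_left sum_distrib_right)
  also have "\<dots> = (\<Sum>s\<in>S \<rightarrow>\<^sub>E I. complex_of_real (?w s * (cmod (?D s))\<^sup>2))"
    by (subst leibniz_det_transpose[OF fin(1)])
       (simp only: mult.assoc complex_norm_square[symmetric] of_real_mult)
  finally have eq: "of_nat (fact (card S)) * ?X =
      complex_of_real (\<Sum>s\<in>S \<rightarrow>\<^sub>E I. ?w s * (cmod (?D s))\<^sup>2)"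
    by (simp add: card_permutations[OF refl fin(1)])
  have nonneg: "0 \<le> (\<Sum>s\<in>S \<rightarrow>\<^sub>E I. ?w s * (cmod (?D s))\<^sup>2) / fact (card S)"
    using c by (intro divide_nonneg_pos sum_nonneg mult_nonneg_nonneg prod_nonneg fact_gt_zero)
      (auto simp: PiE_iff)
  have "(of_nat (fact (card S)) :: complex) \<noteq> 0" by simp
  then have "?X = of_nat (fact (card S)) * ?X / of_nat (fact (card S))"
    by (rule nonzero_mult_div_cancel_left[symmetric])
  also have "\<dots> = complex_of_real (\<Sum>s\<in>S \<rightarrow>\<^sub>E I. ?w s * (cmod (?D s))\<^sup>2) / of_nat (fact (card S))"
    by (simp only: eq)
  also have "\<dots> = complex_of_real ((\<Sum>s\<in>S \<rightarrow>\<^sub>E I. ?w s * (cmod (?D s))\<^sup>2) / fact (card S))"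
    by (simp only: of_real_divide of_nat_fact of_real_fact)
  finally have X': "?X = \<dots>" .
  show ?thesis unfolding X' by (rule complex_of_real_nonneg[OF nonneg])
qed

lemma leibniz_det_diagonal:
  fixes d :: "'i \<Rightarrow> 'b::comm_ring_1"
  assumes fin: "finite S"
  shows "leibniz_det S (\<lambda>i j. if i = j then d i else 0) = (\<Prod>i\<in>S. d i)"
proof -
  have "leibniz_det T (\<lambda>i j. 0 ::'b) = (if T = {} then 1 else 0)" if "T \<in> Pow S" for T
  proof -
    have "finite T" using that fin by (auto intro: finite_subset)
    then show ?thesis
      by (cases "T = {}") (simp_all add: leibniz_det_def zero_power card_gt_0_iff)
  qed
  then have "leibniz_det S (\<lambda>i j. (if i = j then 1 else 0) + (0::'b)) = (\<Sum>T\<in>Pow S. if T = {} then 1 else 0)"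
    unfolding leibniz_det_one_plus[OF fin] by (intro sum.cong) auto
  also have "\<dots> = 1" using fin by (subst sum.delta) auto
  finally have "leibniz_det S (\<lambda>i j. if i = j then 1 else (0::'b)) = 1"
    by (simp only: add_0_right)
  then show ?thesis
    using leibniz_det_scale_rows[of S d "\<lambda>i j. if i = j then 1 else 0"]
    by (simp add: if_distrib cong: if_cong)
qed

lemma norm_leibniz_det_le:
  fixes B :: "'i \<Rightarrow> 'i \<Rightarrow> 'b::real_normed_field"
  assumes fin: "finite S" and B: "\<And>i j. i \<in> S \<Longrightarrow> j \<in> S \<Longrightarrow> norm (B i j) \<le> r i * r j"
    and r: "\<And>i. r i \<ge> 0"
  shows "norm (leibniz_det S B) \<le> fact (card S) * (\<Prod>i\<in>S. (r i)\<^sup>2)"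
proof -
  have "norm (leibniz_det S B) \<le> (\<Sum>p | p permutes S. \<Prod>i\<in>S. (r i)\<^sup>2)"
    unfolding leibniz_det_def
  proof (rule sum_norm_le)
    fix p assume p: "p \<in> {p. p permutes S}"
    have s: "norm (of_int (sign p) :: 'b) = 1" 
      by (simp only: norm_of_int of_int_abs[symmetric] abs_sign of_int_1)
    have "norm (of_int (sign p) * (\<Prod>i\<in>S. B i (p i))) = (\<Prod>i\<in>S. norm (B i (p i)))"
      by (simp only: norm_mult s prod_norm mult_1)
    also have "\<dots> \<le> (\<Prod>i\<in>S. r i * r (p i))"
      using p B by (intro prod_mono) (auto simp: permutes_in_image)
    also have "\<dots> = (\<Prod>i\<in>S. (r i)\<^sup>2)"
      using p prod.permute[of p S r] by (simp add: prod.distrib power2_eq_square o_def)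
    finally show "norm (of_int (sign p) * (\<Prod>i\<in>S. B i (p i))) \<le> (\<Prod>i\<in>S. (r i)\<^sup>2)" .
  qed
  also have "\<dots> = fact (card S) * (\<Prod>i\<in>S. (r i)\<^sup>2)"
    by (simp add: card_permutations[OF refl fin])
  finally show ?thesis .
qed

lemma tendsto_leibniz_det:
  fixes B :: "'a \<Rightarrow> 'i \<Rightarrow> 'i \<Rightarrow> 'b::real_normed_field"
  assumes "\<And>i j. i \<in> S \<Longrightarrow> j \<in> S \<Longrightarrow> ((\<lambda>m. B m i j) \<longlongrightarrow> L i j) F"
  shows "((\<lambda>m. leibniz_det S (B m)) \<longlongrightarrow> leibniz_det S L) F"
  unfolding leibniz_det_def
  by (intro tendsto_sum tendsto_mult tendsto_const tendsto_prod assms) (auto simp: permutes_in_image)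

section \<open>Fredholm expansions\<close>

lemma fermi_weight:
  assumes a: "\<And>n. a n \<ge> 0" "summable a" and lam: "lam > (0::real)"
  shows "\<And>n. 0 \<le> lam * a n / (1 + lam * a n)" and "summable (\<lambda>n. lam * a n / (1 + lam * a n))"
proof -
  have pos: "1 + lam * a n > 0" for n using a(1)[of n] lam by (simp add: add_pos_nonneg)
  show nonneg: "0 \<le> lam * a n / (1 + lam * a n)" for n
    using a(1)[of n] lam pos[of n] by simp
  show "summable (\<lambda>n. lam * a n / (1 + lam * a n))"
  proof (rule summable_comparison_test'[OF summable_mult[OF a(2), of lam]])
    fix n
    show "norm (lam * a n / (1 + lam * a n)) \<le> lam * a n"
      using a(1)[of n] lam pos[of n] by (simp add: divide_le_eq mult_le_cancel_left1)
  qed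
qed

lemma (in product_sigma_finite) AE_PiM_component_finite:
  assumes fin: "finite I" and i: "i \<in> I" and P: "AE x in M i. P x"
  shows "AE x in PiM I M. P (x i)"
proof -
  obtain N where N: "{x \<in> space (M i). \<not> P x} \<subseteq> N" "N \<in> null_sets (M i)"
    using P by (auto elim!: AE_E)
  let ?A = "Pi\<^sub>E I (\<lambda>j. if j = i then N else space (M j))"
  have sets: "?A \<in> sets (PiM I M)"
    using N(2) fin by (intro sets_PiM_I_finite) auto
  have "emeasure (PiM I M) ?A = (\<Prod>j\<in>I. emeasure (M j) (if j = i then N else space (M j)))"
    using N(2) fin by (intro emeasure_PiM) auto
  also have "\<dots> = 0"
    using N(2) fin i by (intro prod_zero) (auto intro!: bexI[of _ i])
  finally have "?A \<in> null_sets (PiM I M)" using sets by auto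
  moreover have "{x \<in> space (PiM I M). \<not> P (x i)} \<subseteq> ?A"
    using N(1) i by (auto simp: space_PiM PiE_iff extensional_def)
  ultimately show ?thesis by (rule AE_I')
qed

definition partial_kernel ::
    "(nat \<Rightarrow> real) \<Rightarrow> (nat \<Rightarrow> 'a \<Rightarrow> complex) \<Rightarrow> nat \<Rightarrow> 'a \<Rightarrow> 'a \<Rightarrow> complex" where
  "partial_kernel c \<psi> m x y = (\<Sum>n<m. complex_of_real (c n) * \<psi> n x * cnj (\<psi> n y))"

locale orthonormal_family = sigma_finite_measure M for M :: "'a measure" +
  fixes \<psi> :: "nat \<Rightarrow> 'a \<Rightarrow> complex"
  assumes orthonormal: "orthonormal_L2 M \<psi>"
begin

sublocale product_sigma_finite "\<lambda>_::nat. M" ..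

lemma measurable_family[measurable]: "\<psi> n \<in> borel_measurable M"
  and integrable_norm_square: "integrable M (\<lambda>x. (cmod (\<psi> n x))\<^sup>2)"
  and integral_family: "(\<integral>x. \<psi> m x * cnj (\<psi> n x) \<partial>M) = (if m = n then 1 else 0)"
  using orthonormal by (auto simp: orthonormal_L2_def)

lemma integral_norm_square: "(\<integral>x. (cmod (\<psi> n x))\<^sup>2 \<partial>M) = 1"
proof -
  have "complex_of_real (\<integral>x. (cmod (\<psi> n x))\<^sup>2 \<partial>M) = (\<integral>x. \<psi> n x * cnj (\<psi> n x) \<partial>M)"
    unfolding complex_norm_square[symmetric] by (rule integral_complex_of_real[symmetric])
  then show ?thesis by (simp add: integral_family)
qed

lemma measurable_kernel_det:
  assumes "\<And>i j. i < N \<Longrightarrow> j < N \<Longrightarrow> (\<lambda>x. K (x i) (x j)) \<in> borel_measurable (power_measure M N)"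
  shows "kernel_det K N \<in> borel_measurable (power_measure M N)"
  unfolding kernel_det_eq_leibniz_det[abs_def] leibniz_det_def
  by (intro borel_measurable_sum borel_measurable_times borel_measurable_const
        borel_measurable_prod assms)
     (auto dest: permutes_in_image)

lemma measurable_cnj_family[measurable]: "(\<lambda>x. cnj (\<psi> n x)) \<in> borel_measurable M"
  by (rule measurable_compose[OF measurable_family borel_measurable_continuous_onI])
     (intro continuous_intros)

lemma measurable_coordinate:
  assumes "f \<in> borel_measurable M" "i < N"
  shows "(\<lambda>x. f (x i)) \<in> borel_measurable (power_measure M N)"
  by (rule measurable_compose[where f = "\<lambda>x. x i", OF measurable_component_singleton assms(1)])
     (use assms(2) in simp)

lemmas measurable_family_component[measurable (raw)] =
  measurable_coordinate[OF measurable_family] measurable_coordinate[OF measurable_cnj_family]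

lemma measurable_kernel_det_series[measurable]:
  "kernel_det (series_kernel c \<psi>) N \<in> borel_measurable (power_measure M N)"
  by (rule measurable_kernel_det) (unfold series_kernel_def, measurable)

lemma measurable_kernel_det_partial[measurable]:
  "kernel_det (partial_kernel c \<psi> m) N \<in> borel_measurable (power_measure M N)"
  by (rule measurable_kernel_det) (unfold partial_kernel_def, measurable)

definition gram :: "('a \<Rightarrow> complex) \<Rightarrow> nat \<Rightarrow> nat \<Rightarrow> complex" where
  "gram h i j = (\<integral>x. h x * \<psi> i x * cnj (\<psi> j x) \<partial>M)"

lemma integrable_gram:
  assumes [measurable]: "h \<in> borel_measurable M" and h: "\<And>x. cmod (h x) \<le> C"
  shows "integrable M (\<lambda>x. h x * \<psi> i x * cnj (\<psi> j x))"
proof (rule Bochner_Integration.integrable_bound)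
  show "integrable M (\<lambda>x. C * ((cmod (\<psi> i x))\<^sup>2 + (cmod (\<psi> j x))\<^sup>2))"
    using integrable_norm_square by simp
  have "cmod (h x * \<psi> i x * cnj (\<psi> j x)) \<le> C * ((cmod (\<psi> i x))\<^sup>2 + (cmod (\<psi> j x))\<^sup>2)" for x
  proof -
    have "cmod (\<psi> i x) * cmod (\<psi> j x) \<le> (cmod (\<psi> i x))\<^sup>2 + (cmod (\<psi> j x))\<^sup>2"
      using sum_squares_bound[of "cmod (\<psi> i x)" "cmod (\<psi> j x)"]
        mult_nonneg_nonneg[OF norm_ge_zero norm_ge_zero, of "\<psi> i x" "\<psi> j x"] by linarith
    then have "cmod (h x) * (cmod (\<psi> i x) * cmod (\<psi> j x)) \<le> C * ((cmod (\<psi> i x))\<^sup>2 + (cmod (\<psi> j x))\<^sup>2)"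
      using h[of x] by (intro mult_mono) (auto intro: order_trans[OF norm_ge_zero])
    then show ?thesis by (simp add: norm_mult mult.assoc)
  qed
  then show "AE x in M. norm (h x * \<psi> i x * cnj (\<psi> j x)) \<le>
      norm (C * ((cmod (\<psi> i x))\<^sup>2 + (cmod (\<psi> j x))\<^sup>2))"
    by (intro AE_I2) (auto intro: order_trans[OF _ abs_ge_self])
qed measurable

lemma prod_times_kernel_det_partial:
  "(\<Prod>j<N. h (x j)) * kernel_det (partial_kernel c \<psi> m) N x =
    (\<Sum>s\<in>{..<N} \<rightarrow>\<^sub>E {..<m}. \<Sum>p | p permutes {..<N}. of_int (sign p) *
      (\<Prod>i<N. complex_of_real (c (s i)) * (h (x i) * \<psi> (s i) (x i) * cnj (\<psi> (s (p i)) (x i)))))"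
proof -
  have "kernel_det (partial_kernel c \<psi> m) N x =
      (\<Sum>s\<in>{..<N} \<rightarrow>\<^sub>E {..<m}. (\<Prod>i<N. complex_of_real (c (s i)) * \<psi> (s i) (x i)) *
        leibniz_det {..<N} (\<lambda>i j. cnj (\<psi> (s i) (x j))))"
    unfolding kernel_det_eq_leibniz_det partial_kernel_def
    by (rule leibniz_det_sum_expand) auto
  also have "\<dots> = (\<Sum>s\<in>{..<N} \<rightarrow>\<^sub>E {..<m}. (\<Prod>i<N. complex_of_real (c (s i)) * \<psi> (s i) (x i)) *
        leibniz_det {..<N} (\<lambda>i j. cnj (\<psi> (s j) (x i))))"
    by (subst leibniz_det_transpose[symmetric]) auto
  finally show ?thesis
    by (simp add: leibniz_det_def sum_distrib_left prod.distrib mult_ac)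
qed

lemma
  assumes [measurable]: "h \<in> borel_measurable M" and h: "\<And>x. cmod (h x) \<le> C"
  shows integrable_kernel_det_partial:
      "integrable (power_measure M N) (\<lambda>x. (\<Prod>j<N. h (x j)) * kernel_det (partial_kernel c \<psi> m) N x)"
    and integral_kernel_det_partial:
      "(\<integral>x. (\<Prod>j<N. h (x j)) * kernel_det (partial_kernel c \<psi> m) N x \<partial>power_measure M N) =
        (\<Sum>s\<in>{..<N} \<rightarrow>\<^sub>E {..<m}. leibniz_det {..<N} (\<lambda>i j. complex_of_real (c (s i)) * gram h (s i) (s j)))"
proof -
  let ?f = "\<lambda>s p i x. complex_of_real (c (s i)) * (h x * \<psi> (s i) x * cnj (\<psi> (s (p i)) x))"
  have int1: "integrable M (?f s p i)" for s p i
    by (intro integrable_mult_right integrable_gram[OF assms])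
  have int: "integrable (power_measure M N) (\<lambda>x. \<Prod>i<N. ?f s p i (x i))" for s p
    by (rule product_integrable_prod) (auto intro: int1)
  have eq: "(\<integral>x. (\<Prod>i<N. ?f s p i (x i)) \<partial>power_measure M N) =
      (\<Prod>i<N. complex_of_real (c (s i)) * gram h (s i) (s (p i)))" for s p
    by (subst product_integral_prod[OF _ int1]) (simp_all add: gram_def)
  show "integrable (power_measure M N) (\<lambda>x. (\<Prod>j<N. h (x j)) * kernel_det (partial_kernel c \<psi> m) N x)"
    unfolding prod_times_kernel_det_partial
    by (intro Bochner_Integration.integrable_sum integrable_mult_right int)
  show "(\<integral>x. (\<Prod>j<N. h (x j)) * kernel_det (partial_kernel c \<psi> m) N x \<partial>power_measure M N) =
        (\<Sum>s\<in>{..<N} \<rightarrow>\<^sub>E {..<m}. leibniz_det {..<N} (\<lambda>i j. complex_of_real (c (s i)) * gram h (s i) (s j)))"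
    unfolding prod_times_kernel_det_partial leibniz_det_def
    by (simp add: Bochner_Integration.integral_sum int eq)
qed

lemma norm_integral_kernel_det_partial_le:
  assumes [measurable]: "h \<in> borel_measurable M" and h: "\<And>x. cmod (h x) \<le> C"
    and c: "\<And>n. c n \<ge> 0" "summable c"
  shows "cmod (\<integral>x. (\<Prod>j<N. h (x j)) * kernel_det (partial_kernel c \<psi> m) N x \<partial>power_measure M N)
    \<le> (C * suminf c) ^ N"
proof -
  let ?D = "kernel_det (partial_kernel c \<psi> m) N"
  have nonneg: "0 \<le> ?D x" for x
    unfolding kernel_det_eq_leibniz_det partial_kernel_def
    by (rule leibniz_det_gram_nonneg) (use c in auto)
  then have D: "?D x = complex_of_real (cmod (?D x))" for x
    using nonneg[of x] by (auto simp: less_eq_complex_def complex_eq_iff cmod_def)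
  have C: "C \<ge> 0" using h order_trans[OF norm_ge_zero] by blast
  have int: "integrable (power_measure M N) ?D"
    using integrable_kernel_det_partial[of "\<lambda>_. 1" 1] by simp
  have gram1: "gram (\<lambda>_. 1) i j = (if i = j then 1 else 0)" for i j
    by (simp add: gram_def integral_family)
  have bound: "cmod (leibniz_det {..<N} (\<lambda>i j. complex_of_real (c (s i)) * gram (\<lambda>_. 1) (s i) (s j)))
      \<le> (\<Prod>i<N. c (s i))" for s
  proof (cases "inj_on s {..<N}")
    case True
    have "leibniz_det {..<N} (\<lambda>i j. complex_of_real (c (s i)) * gram (\<lambda>_. 1) (s i) (s j)) =
        leibniz_det {..<N} (\<lambda>i j. if i = j then complex_of_real (c (s i)) else 0)"
      by (rule leibniz_det_cong) (use True in \<open>auto simp: gram1 inj_on_eq_iff\<close>)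
    also have "\<dots> = complex_of_real (\<Prod>i<N. c (s i))"
      by (simp add: leibniz_det_diagonal)
    finally show ?thesis using c by (simp add: prod_nonneg del: of_real_prod)
  next
    case False
    then have "leibniz_det {..<N} (\<lambda>i j. complex_of_real (c (s i)) * gram (\<lambda>_. 1) (s i) (s j)) = 0"
      by (rule leibniz_det_repeated_index[where B = "\<lambda>k j. complex_of_real (c k) * gram (\<lambda>_. 1) k (s j)", OF finite_lessThan])
    then show ?thesis using c by (simp add: prod_nonneg)
  qed
  have "cmod (\<integral>x. (\<Prod>j<N. h (x j)) * ?D x \<partial>power_measure M N) \<le>
      (\<integral>x. cmod ((\<Prod>j<N. h (x j)) * ?D x) \<partial>power_measure M N)"
    by (rule integral_norm_bound)
  also have "\<dots> \<le> (\<integral>x. C ^ N * cmod (?D x) \<partial>power_measure M N)"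
  proof (rule integral_mono)
    show "integrable (power_measure M N) (\<lambda>x. cmod ((\<Prod>j<N. h (x j)) * ?D x))"
      by (intro integrable_norm integrable_kernel_det_partial[OF assms(1,2)])
    show "integrable (power_measure M N) (\<lambda>x. C ^ N * cmod (?D x))"
      using int by simp
    fix x
    have "cmod (\<Prod>j<N. h (x j)) \<le> (\<Prod>j<N. C)"
      unfolding prod_norm[symmetric] by (intro prod_mono) (auto simp: h)
    then show "cmod ((\<Prod>j<N. h (x j)) * ?D x) \<le> C ^ N * cmod (?D x)"
      by (simp add: norm_mult mult_right_mono)
  qed
  also have "\<dots> = C ^ N * (\<integral>x. cmod (?D x) \<partial>power_measure M N)" by simp
  also have "(\<integral>x. cmod (?D x) \<partial>power_measure M N) = cmod (\<integral>x. ?D x \<partial>power_measure M N)"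
  proof -
    have "(\<integral>x. ?D x \<partial>power_measure M N) = complex_of_real (\<integral>x. cmod (?D x) \<partial>power_measure M N)"
      by (subst D) (rule integral_complex_of_real)
    moreover have "0 \<le> (\<integral>x. cmod (?D x) \<partial>power_measure M N)" by simp
    ultimately show ?thesis by simp
  qed
  also have "\<dots> \<le> (\<Sum>s\<in>{..<N} \<rightarrow>\<^sub>E {..<m}. \<Prod>i<N. c (s i))"
    using integral_kernel_det_partial[of "\<lambda>_. 1" 1 N c m]
    by (auto intro!: sum_norm_le bound)
  also have "\<dots> = (\<Prod>i<N. \<Sum>n<m. c n)"
    by (subst prod_sum_PiE) auto
  also have "\<dots> \<le> suminf c ^ N"
    using c by (simp add: power_mono sum_nonneg sum_le_suminf)
  finally show ?thesis using C by (simp add: power_mult_distrib mult_left_mono)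
qed

lemma AE_summable_and_integrable:
  assumes c: "\<And>n. c n \<ge> 0" "summable c"
  shows "AE x in M. summable (\<lambda>n. c n * (cmod (\<psi> n x))\<^sup>2)"
    and "integrable M (\<lambda>x. \<Sum>n. c n * (cmod (\<psi> n x))\<^sup>2)"
proof -
  let ?f = "\<lambda>n x. c n * (cmod (\<psi> n x))\<^sup>2"
  have nn: "(\<integral>\<^sup>+x. (\<Sum>n. ennreal (?f n x)) \<partial>M) = ennreal (suminf c)"
  proof -
    have "(\<integral>\<^sup>+x. ennreal (?f n x) \<partial>M) = ennreal (c n)" for n
      using c integrable_norm_square
      by (subst nn_integral_eq_integral) (auto simp: integral_norm_square)
    then show ?thesis
      using c by (subst nn_integral_suminf) (auto simp: suminf_ennreal2)
  qed
  have "AE x in M. (\<Sum>n. ennreal (?f n x)) \<noteq> \<infinity>"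
    by (rule nn_integral_PInf_AE) (auto simp: nn)
  then show AE: "AE x in M. summable (\<lambda>n. ?f n x)"
    by eventually_elim (use c in \<open>auto intro!: summable_suminf_not_top\<close>)
  show "integrable M (\<lambda>x. \<Sum>n. ?f n x)"
  proof (rule integrableI_bounded)
    have "(\<integral>\<^sup>+x. ennreal (norm (\<Sum>n. ?f n x)) \<partial>M) = (\<integral>\<^sup>+x. (\<Sum>n. ennreal (?f n x)) \<partial>M)"
      using c by (intro nn_integral_cong_AE eventually_mono[OF AE])
        (auto simp: suminf_ennreal2 suminf_nonneg)
    then show "(\<integral>\<^sup>+x. ennreal (norm (\<Sum>n. ?f n x)) \<partial>M) < \<infinity>" by (simp add: nn)
  qed measurable
qed

end

lemma partial_kernel_tendsto:
  assumes c: "\<And>n. c n \<ge> 0"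
    and x: "summable (\<lambda>n. c n * (cmod (\<psi> n x))\<^sup>2)" and y: "summable (\<lambda>n. c n * (cmod (\<psi> n y))\<^sup>2)"
  shows "(\<lambda>m. partial_kernel c \<psi> m x y) \<longlonglongrightarrow> series_kernel c \<psi> x y"
proof -
  have "summable (\<lambda>n. complex_of_real (c n) * \<psi> n x * cnj (\<psi> n y))"
  proof (rule summable_comparison_test'[OF summable_add[OF x y]])
    fix n
    have "cmod (\<psi> n x) * cmod (\<psi> n y) \<le> (cmod (\<psi> n x))\<^sup>2 + (cmod (\<psi> n y))\<^sup>2"
      using sum_squares_bound[of "cmod (\<psi> n x)" "cmod (\<psi> n y)"]
        mult_nonneg_nonneg[OF norm_ge_zero norm_ge_zero, of "\<psi> n x" "\<psi> n y"] by linarith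
    then show "cmod (complex_of_real (c n) * \<psi> n x * cnj (\<psi> n y)) \<le>
        c n * (cmod (\<psi> n x))\<^sup>2 + c n * (cmod (\<psi> n y))\<^sup>2"
      using c[of n] mult_left_mono[OF _ c[of n]] by (simp add: norm_mult mult.assoc distrib_left[symmetric])
  qed
  from summable_LIMSEQ[OF this] show ?thesis by (simp add: partial_kernel_def series_kernel_def)
qed

lemma norm_partial_kernel_le:
  assumes c: "\<And>n. c n \<ge> 0"
    and x: "summable (\<lambda>n. c n * (cmod (\<psi> n x))\<^sup>2)" and y: "summable (\<lambda>n. c n * (cmod (\<psi> n y))\<^sup>2)"
  shows "cmod (partial_kernel c \<psi> m x y) \<le>
    sqrt (\<Sum>n. c n * (cmod (\<psi> n x))\<^sup>2) * sqrt (\<Sum>n. c n * (cmod (\<psi> n y))\<^sup>2)"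
proof -
  have L2: "L2_set (\<lambda>n. sqrt (c n) * cmod (\<psi> n z)) {..<m} \<le> sqrt (\<Sum>n. c n * (cmod (\<psi> n z))\<^sup>2)"
    if "summable (\<lambda>n. c n * (cmod (\<psi> n z))\<^sup>2)" for z
    using c that unfolding L2_set_def
    by (intro real_sqrt_le_mono) (auto simp: power_mult_distrib intro!: sum_le_suminf)
  have "cmod (partial_kernel c \<psi> m x y) \<le>
      (\<Sum>n<m. \<bar>sqrt (c n) * cmod (\<psi> n x)\<bar> * \<bar>sqrt (c n) * cmod (\<psi> n y)\<bar>)"
    unfolding partial_kernel_def
  proof (rule sum_norm_le)
    fix n
    have "\<bar>sqrt (c n) * cmod (\<psi> n x)\<bar> * \<bar>sqrt (c n) * cmod (\<psi> n y)\<bar> =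
        (sqrt (c n))\<^sup>2 * cmod (\<psi> n x) * cmod (\<psi> n y)"
      using c[of n] by (simp only: abs_mult power2_eq_square abs_norm_cancel mult_ac abs_of_nonneg real_sqrt_ge_zero)
    also have "\<dots> = cmod (complex_of_real (c n) * \<psi> n x * cnj (\<psi> n y))"
      using c[of n] by (simp add: norm_mult)
    finally show "cmod (complex_of_real (c n) * \<psi> n x * cnj (\<psi> n y)) \<le>
        \<bar>sqrt (c n) * cmod (\<psi> n x)\<bar> * \<bar>sqrt (c n) * cmod (\<psi> n y)\<bar>"
      by (simp only: order_refl)
  qed
  also have "\<dots> \<le> L2_set (\<lambda>n. sqrt (c n) * cmod (\<psi> n x)) {..<m} *
      L2_set (\<lambda>n. sqrt (c n) * cmod (\<psi> n y)) {..<m}"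
    by (rule L2_set_mult_ineq)
  also have "\<dots> \<le> sqrt (\<Sum>n. c n * (cmod (\<psi> n x))\<^sup>2) * sqrt (\<Sum>n. c n * (cmod (\<psi> n y))\<^sup>2)"
    using c by (intro mult_mono L2 x y) (auto intro!: suminf_nonneg x)
  finally show ?thesis .
qed

context orthonormal_family begin

lemma
  assumes h[measurable]: "h \<in> borel_measurable M" and hC: "\<And>x. cmod (h x) \<le> C"
    and c: "\<And>n. c n \<ge> 0" "summable c"
  shows integrable_kernel_det_series:
      "integrable (power_measure M N) (\<lambda>x. (\<Prod>j<N. h (x j)) * kernel_det (series_kernel c \<psi>) N x)"
    and integral_kernel_det_partial_tendsto:
      "(\<lambda>m. \<integral>x. (\<Prod>j<N. h (x j)) * kernel_det (partial_kernel c \<psi> m) N x \<partial>power_measure M N)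
        \<longlonglongrightarrow> (\<integral>x. (\<Prod>j<N. h (x j)) * kernel_det (series_kernel c \<psi>) N x \<partial>power_measure M N)"
proof -
  define rho where "rho x = (\<Sum>n. c n * (cmod (\<psi> n x))\<^sup>2)" for x
  let ?good = "\<lambda>x. summable (\<lambda>n. c n * (cmod (\<psi> n x))\<^sup>2)"
  let ?w = "\<lambda>x. C ^ N * (fact N * (\<Prod>i<N. rho (x i)))"
  have good: "AE x in power_measure M N. \<forall>i\<in>{..<N}. ?good (x i)"
    by (intro AE_finite_allI finite_lessThan AE_PiM_component_finite)
       (use AE_summable_and_integrable(1)[OF c] in auto)
  have mh: "(\<lambda>x. \<Prod>j<N. h (x j)) \<in> borel_measurable (power_measure M N)"
    by (intro borel_measurable_prod measurable_coordinate h) auto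
  have m1: "(\<lambda>x. (\<Prod>j<N. h (x j)) * kernel_det (series_kernel c \<psi>) N x) \<in> borel_measurable (power_measure M N)"
    using mh by measurable
  have m2: "(\<lambda>x. (\<Prod>j<N. h (x j)) * kernel_det (partial_kernel c \<psi> m) N x) \<in> borel_measurable (power_measure M N)" for m
    using mh by measurable
  have w: "integrable (power_measure M N) ?w"
    using AE_summable_and_integrable(2)[OF c]
    by (intro integrable_mult_right product_integrable_prod) (auto simp: rho_def[abs_def])
  have lim: "AE x in power_measure M N.
      (\<lambda>m. (\<Prod>j<N. h (x j)) * kernel_det (partial_kernel c \<psi> m) N x)
        \<longlonglongrightarrow> (\<Prod>j<N. h (x j)) * kernel_det (series_kernel c \<psi>) N x"
    using good
  proof eventually_elim
    case (elim x)
    then show ?case unfolding kernel_det_eq_leibniz_det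
      by (intro tendsto_mult tendsto_const tendsto_leibniz_det partial_kernel_tendsto c) auto
  qed
  have bound: "AE x in power_measure M N.
      norm ((\<Prod>j<N. h (x j)) * kernel_det (partial_kernel c \<psi> m) N x) \<le> ?w x" for m
    using good
  proof eventually_elim
    case (elim x)
    define r where "r i = sqrt (if ?good (x i) then rho (x i) else 0)" for i
    have r: "r i \<ge> 0" for i
      using c by (auto simp: r_def rho_def intro!: suminf_nonneg)
    have "cmod (kernel_det (partial_kernel c \<psi> m) N x) \<le> fact (card {..<N}) * (\<Prod>i<N. (r i)\<^sup>2)"
      unfolding kernel_det_eq_leibniz_det
    proof (rule norm_leibniz_det_le[OF _ _ r])
      fix i j assume "i \<in> {..<N}" "j \<in> {..<N}"
      then show "cmod (partial_kernel c \<psi> m (x i) (x j)) \<le> r i * r j"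
        using elim norm_partial_kernel_le[of c \<psi> "x i" "x j" m] c by (auto simp: r_def rho_def)
    qed simp
    also have "(\<Prod>i<N. (r i)\<^sup>2) = (\<Prod>i<N. rho (x i))"
    proof (rule prod.cong)
      fix i assume "i \<in> {..<N}"
      then show "(r i)\<^sup>2 = rho (x i)"
        using elim c by (auto simp: r_def rho_def intro!: suminf_nonneg)
    qed simp
    finally have D: "cmod (kernel_det (partial_kernel c \<psi> m) N x) \<le> fact N * (\<Prod>i<N. rho (x i))"
      by simp
    have "cmod (\<Prod>j<N. h (x j)) \<le> (\<Prod>j<N. C)"
      unfolding prod_norm[symmetric] by (intro prod_mono) (auto simp: hC)
    then have "cmod (\<Prod>j<N. h (x j)) \<le> C ^ N" by simp
    then show ?case
      unfolding norm_mult using D order_trans[OF norm_ge_zero hC] by (intro mult_mono) auto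
  qed
  show "integrable (power_measure M N) (\<lambda>x. (\<Prod>j<N. h (x j)) * kernel_det (series_kernel c \<psi>) N x)"
    by (rule integrable_dominated_convergence[OF m1 m2 w lim bound])
  show "(\<lambda>m. \<integral>x. (\<Prod>j<N. h (x j)) * kernel_det (partial_kernel c \<psi> m) N x \<partial>power_measure M N)
        \<longlonglongrightarrow> (\<integral>x. (\<Prod>j<N. h (x j)) * kernel_det (series_kernel c \<psi>) N x \<partial>power_measure M N)"
    by (rule integral_dominated_convergence[OF m1 m2 w lim bound])
qed

lemma fredholm_partial:
  assumes h[measurable]: "h \<in> borel_measurable M" and hC: "\<And>x. cmod (h x) \<le> C"
  shows "(\<lambda>N. 1 / fact N * (\<integral>x. (\<Prod>j<N. h (x j)) * kernel_det (partial_kernel c \<psi> m) N x \<partial>power_measure M N))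
    sums leibniz_det {..<m} (\<lambda>i j. (if i = j then 1 else 0) + complex_of_real (c i) * gram h i j)"
proof -
  let ?B = "\<lambda>i j. complex_of_real (c i) * gram h i j"
  let ?J = "\<lambda>N. {T. T \<subseteq> {..<m} \<and> card T = N}"
  have eq: "1 / fact N * (\<integral>x. (\<Prod>j<N. h (x j)) * kernel_det (partial_kernel c \<psi> m) N x \<partial>power_measure M N) =
      (\<Sum>T\<in>?J N. leibniz_det T ?B)" for N
    using sum_leibniz_det_functions[OF finite_lessThan[of m], of N ?B]
    by (simp add: integral_kernel_det_partial[OF assms])
  have J: "?J N = {}" if "N \<notin> {..m}" for N
    using that by (auto dest!: card_mono[OF finite_lessThan])
  have "(\<lambda>N. \<Sum>T\<in>?J N. leibniz_det T ?B) sums (\<Sum>N\<le>m. \<Sum>T\<in>?J N. leibniz_det T ?B)"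
    by (intro sums_finite) (simp_all only: finite_atMost J sum.empty not_False_eq_True)
  also have "(\<Sum>N\<le>m. \<Sum>T\<in>?J N. leibniz_det T ?B) =
      (\<Sum>N\<le>m. \<Sum>T\<in>{T \<in> Pow {..<m}. card T = N}. leibniz_det T ?B)"
    by (simp add: Pow_def)
  also have "\<dots> = (\<Sum>T\<in>Pow {..<m}. leibniz_det T ?B)"
    by (rule sum.group) (auto dest!: card_mono[OF finite_lessThan])
  finally show ?thesis by (simp only: eq leibniz_det_one_plus[OF finite_lessThan])
qed

lemma
  assumes h[measurable]: "h \<in> borel_measurable M" and hC: "\<And>x. cmod (h x) \<le> C"
    and c: "\<And>n. c n \<ge> 0" "summable c"
  shows summable_fredholm:
      "summable (\<lambda>N. norm (1 / fact N * (\<integral>x. (\<Prod>j<N. h (x j)) * kernel_det (series_kernel c \<psi>) N x \<partial>power_measure M N)))"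
    and fredholm_tendsto:
      "(\<lambda>m. leibniz_det {..<m} (\<lambda>i j. (if i = j then 1 else 0) + complex_of_real (c i) * gram h i j))
        \<longlonglongrightarrow> (\<Sum>N. 1 / fact N * (\<integral>x. (\<Prod>j<N. h (x j)) * kernel_det (series_kernel c \<psi>) N x \<partial>power_measure M N))"
proof -
  let ?T = "\<lambda>K N. 1 / fact N * (\<integral>x. (\<Prod>j<N. h (x j)) * kernel_det K N x \<partial>power_measure M N)"
  let ?b = "\<lambda>N. (C * suminf c) ^ N / fact N"
  have *: "eventually (\<lambda>m. summable (\<lambda>N. norm (?T (partial_kernel c \<psi> m) N))) sequentially \<and>
      summable (\<lambda>N. norm (?T (series_kernel c \<psi>) N)) \<and>
      (\<lambda>m. \<Sum>N. ?T (partial_kernel c \<psi> m) N) \<longlonglongrightarrow> (\<Sum>N. ?T (series_kernel c \<psi>) N)"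
  proof (rule tannerys_theorem)
    show "(\<lambda>m. ?T (partial_kernel c \<psi> m) N) \<longlonglongrightarrow> ?T (series_kernel c \<psi>) N" for N
      by (intro tendsto_mult tendsto_const integral_kernel_det_partial_tendsto[OF h hC c])
    have "norm (?T (partial_kernel c \<psi> m) N) \<le> ?b N" for m N
      using norm_integral_kernel_det_partial_le[OF h hC c, of N m]
      by (simp add: norm_mult norm_divide divide_right_mono)
    then show "\<forall>\<^sub>F (N, m) in sequentially \<times>\<^sub>F sequentially. norm (?T (partial_kernel c \<psi> m) N) \<le> ?b N"
      by (intro always_eventually) auto
    show "summable ?b"
      using summable_exp_generic[of "C * suminf c"] by (simp add: divide_inverse mult.commute)
  qed simp
  then show "summable (\<lambda>N. norm (?T (series_kernel c \<psi>) N))" by blast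
  show "(\<lambda>m. leibniz_det {..<m} (\<lambda>i j. (if i = j then 1 else 0) + complex_of_real (c i) * gram h i j))
        \<longlonglongrightarrow> (\<Sum>N. ?T (series_kernel c \<psi>) N)"
    using * sums_unique[OF fredholm_partial[OF h hC]] by simp
qed

lemma fredholm_factorization:
  assumes g[measurable]: "g \<in> borel_measurable M" and gC: "\<And>x. cmod (g x) \<le> C"
    and a: "\<And>n. a n \<ge> 0" "summable a" and lam: "lam > 0"
  defines "F \<equiv> \<lambda>h c. \<Sum>N. 1 / fact N * (\<integral>x. (\<Prod>j<N. h (x j)) * kernel_det (series_kernel c \<psi>) N x \<partial>power_measure M N)"
  shows "F (\<lambda>x. complex_of_real lam * (1 + g x)) a =
    F (\<lambda>x. complex_of_real lam) a * F g (\<lambda>n. lam * a n / (1 + lam * a n))"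
proof -
  let ?d = "\<lambda>i j. if i = j then 1 else 0 :: complex"
  define b where "b n = lam * a n / (1 + lam * a n)" for n
  have pos: "1 + lam * a n > 0" for n using a(1)[of n] lam by (simp add: add_pos_nonneg)
  have b0: "\<And>n. b n \<ge> 0" and bs: "summable b"
    using fermi_weight[OF a lam] by (simp_all add: b_def[abs_def])
  have gram1: "gram (\<lambda>x. complex_of_real lam) i j = complex_of_real lam * ?d i j" for i j
    by (simp add: gram_def mult.assoc integral_family)
  have gram2: "gram (\<lambda>x. complex_of_real lam * (1 + g x)) i j =
      complex_of_real lam * (?d i j + gram g i j)" for i j
  proof -
    have "gram (\<lambda>x. complex_of_real lam * (1 + g x)) i j =
        (\<integral>x. complex_of_real lam * (\<psi> i x * cnj (\<psi> j x) + g x * \<psi> i x * cnj (\<psi> j x)) \<partial>M)"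
      unfolding gram_def by (intro Bochner_Integration.integral_cong) (auto simp: algebra_simps)
    also have "\<dots> = complex_of_real lam * ((\<integral>x. \<psi> i x * cnj (\<psi> j x) \<partial>M) + gram g i j)"
      using integrable_gram[OF g gC, of i j] integrable_gram[of "\<lambda>_. 1" 1 i j]
      by (simp add: gram_def)
    finally show ?thesis by (simp add: integral_family)
  qed
  have l1: "leibniz_det {..<m} (\<lambda>i j. ?d i j + complex_of_real (a i) * gram (\<lambda>x. complex_of_real lam) i j) =
      (\<Prod>i<m. complex_of_real (1 + lam * a i))" for m
    by (subst leibniz_det_diagonal[symmetric], simp, rule leibniz_det_cong) (simp add: gram1)
  have l2: "leibniz_det {..<m} (\<lambda>i j. ?d i j + complex_of_real (a i) * gram (\<lambda>x. complex_of_real lam * (1 + g x)) i j) =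
      (\<Prod>i<m. complex_of_real (1 + lam * a i)) *
      leibniz_det {..<m} (\<lambda>i j. ?d i j + complex_of_real (b i) * gram g i j)" for m
  proof (subst leibniz_det_scale_rows[symmetric], rule leibniz_det_cong)
    fix i j
    have "complex_of_real (1 + lam * a i) * complex_of_real (b i) = complex_of_real (lam * a i)"
      using pos[of i] unfolding of_real_mult[symmetric] by (simp add: b_def)
    then show "?d i j + complex_of_real (a i) * gram (\<lambda>x. complex_of_real lam * (1 + g x)) i j =
        complex_of_real (1 + lam * a i) * (?d i j + complex_of_real (b i) * gram g i j)"
      unfolding gram2 by (simp add: distrib_left mult.assoc[symmetric])
  qed
  have t1: "(\<lambda>m. \<Prod>i<m. complex_of_real (1 + lam * a i)) \<longlonglongrightarrow> F (\<lambda>x. complex_of_real lam) a"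
    unfolding F_def l1[symmetric] by (rule fredholm_tendsto[where C = lam]) (use lam a in auto)
  have t2: "(\<lambda>m. leibniz_det {..<m} (\<lambda>i j. ?d i j + complex_of_real (b i) * gram g i j)) \<longlonglongrightarrow> F g b"
    unfolding F_def by (rule fredholm_tendsto[OF g gC b0 bs])
  have "cmod (complex_of_real lam * (1 + g x)) \<le> lam * (1 + C)" for x
    using lam norm_triangle_ineq[of 1 "g x"] gC[of x] by (simp add: norm_mult mult_left_mono)
  then have t3: "(\<lambda>m. (\<Prod>i<m. complex_of_real (1 + lam * a i)) *
      leibniz_det {..<m} (\<lambda>i j. ?d i j + complex_of_real (b i) * gram g i j))
      \<longlonglongrightarrow> F (\<lambda>x. complex_of_real lam * (1 + g x)) a"
    unfolding F_def l2[symmetric] by (intro fredholm_tendsto[where C = "lam * (1 + C)"] a) auto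
  show ?thesis
    using LIMSEQ_unique[OF t3 tendsto_mult[OF t1 t2]] by (simp add: b_def[abs_def])
qed

end

section \<open>Configurations\<close>

lemma config_space_basis: "{{c \<in> configs. particle_count c B = k} | B k. B \<in> sets borel \<and> bounded B}
    \<subseteq> Pow (configs :: ('a::metric_space \<Rightarrow> nat) set)"
  by auto

lemma space_config_space: "space config_space = configs"
  unfolding config_space_def by (rule space_measure_of[OF config_space_basis])

lemma measurable_particle_count:
  assumes "B \<in> sets borel" "bounded B"
  shows "(\<lambda>c. particle_count c B) \<in> measurable config_space (count_space UNIV)"
proof (rule measurableI)
  fix A :: "nat set"
  have "(\<lambda>c. particle_count c B) -` A \<inter> space config_space =
      (\<Union>k\<in>A. {c \<in> configs. particle_count c B = k})"
    by (auto simp: space_config_space)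
  also have "\<dots> \<in> sets config_space"
  proof (rule sets.countable_UN')
    have "{c \<in> configs. particle_count c B = k} \<in> sets config_space" for k
      unfolding config_space_def using assms
      by (subst sets_measure_of[OF config_space_basis]) (auto intro!: sigma_sets.Basic)
    then show "(\<lambda>k. {c \<in> configs. particle_count c B = k}) ` A \<subseteq> sets config_space" by auto
  qed auto
  finally show "(\<lambda>c. particle_count c B) -` A \<inter> space config_space \<in> sets config_space" .
qed auto

lemma particle_count_config_of: "particle_count (config_of N x) B = card {i. i < N \<and> x i \<in> B}"
proof -
  let ?S = "{i. i < N \<and> x i \<in> B}"
  have "{y. y \<in> B \<and> config_of N x y \<noteq> 0} = x ` ?S"
    by (auto simp: config_of_def card_gt_0_iff)
  then have "particle_count (config_of N x) B = (\<Sum>y\<in>x ` ?S. card {i\<in>?S. x i = y})"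
    unfolding particle_count_def by (intro sum.cong) (auto simp: config_of_def intro!: arg_cong[where f=card])
  also have "\<dots> = (\<Sum>y\<in>x ` ?S. \<Sum>i\<in>{i\<in>?S. x i = y}. 1)" by simp
  also have "\<dots> = (\<Sum>i\<in>?S. 1)"
    by (rule sum.group) auto
  finally show ?thesis by simp
qed

lemma config_of_in_configs: "config_of N x \<in> configs"
proof -
  have "{y \<in> B. config_of N x y \<noteq> 0} \<subseteq> x ` {..<N}" for B
    by (auto simp: config_of_def card_gt_0_iff)
  then have "finite {y \<in> B. config_of N x y \<noteq> 0}" for B
    by (rule finite_subset) simp
  then show ?thesis by (simp add: configs_def)
qed

lemma measurable_config_of:
  fixes M :: "'a::metric_space measure"
  assumes M: "sets M = sets borel"
  shows "config_of N \<in> measurable (power_measure M N) config_space"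
  unfolding config_space_def
proof (rule measurable_measure_of[OF config_space_basis])
  show "config_of N \<in> space (power_measure M N) \<rightarrow> configs" by (auto intro: config_of_in_configs)
  fix A assume "A \<in> {{c \<in> configs. particle_count c B = k} | B k. B \<in> sets borel \<and> bounded (B :: 'a set)}"
  then obtain B k where B: "A = {c \<in> configs. particle_count c B = k}" "B \<in> sets M"
    using M by auto
  have "(\<lambda>x. \<Sum>i<N. indicator B (x i) :: real) \<in> borel_measurable (power_measure M N)"
  proof (intro borel_measurable_sum)
    fix i assume "i \<in> {..<N}"
    then show "(\<lambda>x. indicator B (x i) :: real) \<in> borel_measurable (power_measure M N)"
      using B(2) by (intro measurable_compose[where f = "\<lambda>x. x i", OF measurable_component_singleton
          borel_measurable_indicator]) auto
  qed
  then have "{x \<in> space (power_measure M N). (\<Sum>i<N. indicator B (x i) :: real) = real k}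
      \<in> sets (power_measure M N)"
    by measurable
  also have "(\<Sum>i<N. indicator B (x i) :: real) = real (card {i. i < N \<and> x i \<in> B})" for x
    by (simp add: indicator_def sum.If_cases Int_def conj_commute)
  then have "{x \<in> space (power_measure M N). (\<Sum>i<N. indicator B (x i) :: real) = real k} =
      config_of N -` A \<inter> space (power_measure M N)"
    by (auto simp: B(1) config_of_in_configs particle_count_config_of)
  finally show "config_of N -` A \<inter> space (power_measure M N) \<in> sets (power_measure M N)" .
qed

lemma particle_prod_config_of: "particle_prod g (config_of N x) = (\<Prod>j<N. 1 + g (x j))"
proof -
  let ?S = "{i. i < N \<and> g (x i) \<noteq> 0}"
  have eq: "{y. config_of N x y \<noteq> 0 \<and> g y \<noteq> 0} = x ` ?S"
    by (auto simp: config_of_def card_gt_0_iff)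
  have "particle_prod g (config_of N x) = (\<Prod>y\<in>x ` ?S. \<Prod>i\<in>{i\<in>?S. x i = y}. 1 + g (x i))"
    unfolding particle_prod_def eq
  proof (rule prod.cong)
    fix y assume "y \<in> x ` ?S"
    then have "{i\<in>?S. x i = y} = {i. i < N \<and> x i = y}" by auto
    then show "(1 + g y) ^ config_of N x y = (\<Prod>i\<in>{i\<in>?S. x i = y}. 1 + g (x i))"
      by (simp add: config_of_def)
  qed simp
  also have "\<dots> = (\<Prod>i\<in>?S. 1 + g (x i))"
    by (rule prod.group) auto
  also have "\<dots> = (\<Prod>j<N. 1 + g (x j))"
    by (rule prod.mono_neutral_left) auto
  finally show ?thesis .
qed

lemma particle_prod_simple:
  assumes fin: "finite (range g)" and supp: "bounded {x. g x \<noteq> 0}" and c: "c \<in> configs"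
  shows "particle_prod g c = (\<Prod>v\<in>range g - {0}. (1 + v) ^ particle_count c (g -` {v}))"
proof -
  let ?S = "{x. c x \<noteq> 0 \<and> g x \<noteq> 0}"
  have finS: "finite ?S"
    using c supp by (auto simp: configs_def conj_commute)
  have "particle_prod g c = (\<Prod>v\<in>range g - {0}. \<Prod>x\<in>{x\<in>?S. g x = v}. (1 + g x) ^ c x)"
    unfolding particle_prod_def using fin finS by (intro prod.group[symmetric]) auto
  also have "\<dots> = (\<Prod>v\<in>range g - {0}. (1 + v) ^ particle_count c (g -` {v}))"
  proof (rule prod.cong)
    fix v assume "v \<in> range g - {0}"
    then have "{x\<in>?S. g x = v} = {x. x \<in> g -` {v} \<and> c x \<noteq> 0}" by auto
    then show "(\<Prod>x\<in>{x\<in>?S. g x = v}. (1 + g x) ^ c x) = (1 + v) ^ particle_count c (g -` {v})"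
      by (simp add: particle_count_def power_sum)
  qed simp
  finally show ?thesis .
qed

lemma measurable_particle_prod:
  fixes g :: "'a::metric_space \<Rightarrow> complex"
  assumes g: "g \<in> borel_measurable borel" and supp: "bounded {x. g x \<noteq> 0}"
  shows "particle_prod g \<in> borel_measurable config_space"
proof -
  obtain F where F: "\<And>i. simple_function borel (F i)" "\<And>x. (\<lambda>i. F i x) \<longlonglongrightarrow> g x"
    "\<And>i x. dist (F i x) 0 \<le> 2 * dist (g x) 0"
    using borel_measurable_implies_sequence_metric[OF g, of 0] by (auto simp: space_borel)
  have F0: "F i x = 0" if "g x = 0" for i x using F(3)[of i x] that by simp
  then have suppF: "{x. F i x \<noteq> 0} \<subseteq> {x. g x \<noteq> 0}" for i by auto
  have finF: "finite (range (F i))" for i using simple_functionD(1)[OF F(1)] by (simp add: space_borel)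
  show ?thesis
  proof (rule borel_measurable_LIMSEQ_metric)
    fix i
    have meas: "F i -` {v} \<in> sets borel" for v
      using simple_functionD(2)[OF F(1), of i "{v}"] by (simp add: space_borel)
    have "(\<lambda>c. \<Prod>v\<in>range (F i) - {0}. (1 + v) ^ particle_count c (F i -` {v}))
        \<in> borel_measurable config_space"
    proof (intro borel_measurable_prod measurable_compose[OF measurable_particle_count])
      fix v assume "v \<in> range (F i) - {0}"
      then show "bounded (F i -` {v})"
        by (intro bounded_subset[OF bounded_subset[OF supp suppF[of i]]]) auto
    qed (auto intro: meas)
    then show "particle_prod (F i) \<in> borel_measurable config_space"
      by (rule measurable_cong[THEN iffD1, rotated])
         (simp add: space_config_space particle_prod_simple finF bounded_subset[OF supp suppF])
  next
    fix c :: "'a \<Rightarrow> nat" assume "c \<in> space config_space"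
    let ?S = "{x. c x \<noteq> 0 \<and> g x \<noteq> 0}"
    have finS: "finite ?S"
      using \<open>c \<in> _\<close> supp by (auto simp: configs_def space_config_space conj_commute)
    have "particle_prod (F i) c = (\<Prod>x\<in>?S. (1 + F i x) ^ c x)" for i
      unfolding particle_prod_def using finS F0 by (intro prod.mono_neutral_left) auto
    then show "(\<lambda>i. particle_prod (F i) c) \<longlonglongrightarrow> particle_prod g c"
      unfolding particle_prod_def[of g] by (auto intro!: tendsto_intros F(2))
  qed
qed

section \<open>The grand canonical process\<close>

lemma nn_integral_discrete_bind:
  fixes \<kappa> :: "nat \<Rightarrow> 'b measure"
  assumes \<kappa>: "\<And>n. subprob_space (\<kappa> n)" "\<And>n. sets (\<kappa> n) = sets S"
    and F: "F \<in> borel_measurable S"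
  shows "(\<integral>\<^sup>+x. F x \<partial>(density (count_space UNIV) q \<bind> \<kappa>)) = (\<Sum>n. q n * (\<integral>\<^sup>+x. F x \<partial>\<kappa> n))"
proof -
  have "\<kappa> \<in> measurable (density (count_space UNIV) q) (subprob_algebra S)"
    using \<kappa> by (auto simp: measurable_def space_subprob_algebra)
  then show ?thesis
    by (simp add: nn_integral_bind[OF F] nn_integral_density nn_integral_count_space_nat)
qed

lemma integral_discrete_bind:
  fixes \<kappa> :: "nat \<Rightarrow> 'b measure" and f :: "'b \<Rightarrow> complex"
  assumes \<kappa>: "\<And>n. subprob_space (\<kappa> n)" "\<And>n. sets (\<kappa> n) = sets S"
    and q: "\<And>n. q n \<ge> 0" and f[measurable]: "f \<in> borel_measurable S"
    and int: "\<And>n. integrable (\<kappa> n) f"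
    and sm: "summable (\<lambda>n. q n * (\<integral>x. norm (f x) \<partial>\<kappa> n))"
  defines "P \<equiv> density (count_space UNIV) (\<lambda>n. ennreal (q n)) \<bind> \<kappa>"
  shows "integrable P f" and "(\<lambda>n. complex_of_real (q n) * (\<integral>x. f x \<partial>\<kappa> n)) sums (\<integral>x. f x \<partial>P)"
proof -
  have sets_P: "sets P = sets S"
    unfolding P_def by (rule sets_bind) (auto simp: \<kappa>)
  have f_P: "f \<in> borel_measurable P" and f_\<kappa>: "f \<in> borel_measurable (\<kappa> n)" for n
    using f by (simp_all add: measurable_cong_sets[OF sets_P refl] measurable_cong_sets[OF \<kappa>(2) refl])
  have nn: "integrable P u \<and> (\<lambda>n. q n * (\<integral>x. u x \<partial>\<kappa> n)) sums (\<integral>x. u x \<partial>P)"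
    if u: "u \<in> borel_measurable S" "\<And>x. 0 \<le> u x" "\<And>x. u x \<le> norm (f x)" for u
  proof -
    have u_P: "u \<in> borel_measurable P" and u_\<kappa>: "u \<in> borel_measurable (\<kappa> n)" for n
      using u(1) by (simp_all add: measurable_cong_sets[OF sets_P refl] measurable_cong_sets[OF \<kappa>(2) refl])
    have int_u: "integrable (\<kappa> n) u" for n
      using u by (intro Bochner_Integration.integrable_bound[OF int u_\<kappa>]) auto
    have le: "q n * (\<integral>x. u x \<partial>\<kappa> n) \<le> q n * (\<integral>x. norm (f x) \<partial>\<kappa> n)" for n
      by (intro mult_left_mono integral_mono int_u integrable_norm int u q)
    have nonneg: "0 \<le> q n * (\<integral>x. u x \<partial>\<kappa> n)" for n
      by (intro mult_nonneg_nonneg q integral_nonneg_AE) (auto simp: u)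
    have sm_u: "summable (\<lambda>n. q n * (\<integral>x. u x \<partial>\<kappa> n))"
      by (rule summable_comparison_test'[OF sm]) (use le nonneg in auto)
    have "(\<integral>\<^sup>+x. ennreal (u x) \<partial>P) = (\<Sum>n. ennreal (q n) * (\<integral>\<^sup>+x. ennreal (u x) \<partial>\<kappa> n))"
      unfolding P_def using u(1) by (intro nn_integral_discrete_bind[OF \<kappa>]) auto
    also have "\<dots> = (\<Sum>n. ennreal (q n * (\<integral>x. u x \<partial>\<kappa> n)))"
      using int_u u(2) q by (simp add: nn_integral_eq_integral ennreal_mult)
    also have "\<dots> = ennreal (\<Sum>n. q n * (\<integral>x. u x \<partial>\<kappa> n))"
      by (rule suminf_ennreal2[OF nonneg sm_u])
    finally have eq: "(\<integral>\<^sup>+x. ennreal (u x) \<partial>P) = ennreal (\<Sum>n. q n * (\<integral>x. u x \<partial>\<kappa> n))" .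
    have int_P: "integrable P u"
      using eq u(2) by (intro integrableI_bounded u_P) auto
    have "ennreal (\<integral>x. u x \<partial>P) = ennreal (\<Sum>n. q n * (\<integral>x. u x \<partial>\<kappa> n))"
      unfolding eq[symmetric] using u(2) by (intro nn_integral_eq_integral[symmetric] int_P) auto
    then have "(\<integral>x. u x \<partial>P) = (\<Sum>n. q n * (\<integral>x. u x \<partial>\<kappa> n))"
      using u(2) by (subst (asm) ennreal_inj) (auto intro!: suminf_nonneg sm_u nonneg integral_nonneg_AE)
    then show ?thesis using int_P summable_sums[OF sm_u] by simp
  qed
  have real: "integrable P v \<and> (\<lambda>n. q n * (\<integral>x. v x \<partial>\<kappa> n)) sums (\<integral>x. v x \<partial>P)"
    if v: "v \<in> borel_measurable S" "\<And>x. \<bar>v x\<bar> \<le> norm (f x)" for v :: "'b \<Rightarrow> real"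
  proof -
    let ?p = "\<lambda>x. max (v x) 0" and ?m = "\<lambda>x. max (- v x) 0"
    have p: "integrable P ?p \<and> (\<lambda>n. q n * (\<integral>x. ?p x \<partial>\<kappa> n)) sums (\<integral>x. ?p x \<partial>P)"
      by (rule nn) (use v in \<open>auto simp: abs_le_iff\<close>)
    have m: "integrable P ?m \<and> (\<lambda>n. q n * (\<integral>x. ?m x \<partial>\<kappa> n)) sums (\<integral>x. ?m x \<partial>P)"
      by (rule nn) (use v in \<open>auto simp: abs_le_iff\<close>)
    have v_eq: "(\<lambda>x. ?p x - ?m x) = v" by (auto simp: max_def)
    have "v \<in> borel_measurable (\<kappa> n)" for n
      using v(1) by (simp add: measurable_cong_sets[OF \<kappa>(2) refl])
    then have "integrable (\<kappa> n) v" for n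
      using v(2) by (intro Bochner_Integration.integrable_bound[OF int]) auto
    then have ints: "integrable (\<kappa> n) ?p" "integrable (\<kappa> n) ?m" for n by auto
    have "integrable P (\<lambda>x. ?p x - ?m x)" using p m by (intro Bochner_Integration.integrable_diff) auto
    then have "integrable P v" by (simp only: v_eq)
    moreover have "(\<lambda>n. q n * (\<integral>x. ?p x \<partial>\<kappa> n) - q n * (\<integral>x. ?m x \<partial>\<kappa> n)) sums
        ((\<integral>x. ?p x \<partial>P) - (\<integral>x. ?m x \<partial>P))"
      using p m by (intro sums_diff) auto
    moreover have "q n * (\<integral>x. ?p x \<partial>\<kappa> n) - q n * (\<integral>x. ?m x \<partial>\<kappa> n) = q n * (\<integral>x. v x \<partial>\<kappa> n)" for n
      by (simp only: right_diff_distrib[symmetric] Bochner_Integration.integral_diff[OF ints, symmetric] v_eq)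
    moreover have "(\<integral>x. ?p x \<partial>P) - (\<integral>x. ?m x \<partial>P) = (\<integral>x. v x \<partial>P)"
      using p m by (simp only: Bochner_Integration.integral_diff[symmetric] v_eq)
    ultimately show ?thesis by simp
  qed
  show int_f: "integrable P f"
    using nn[of "\<lambda>x. norm (f x)"] f f_P by (simp add: integrable_norm_iff)
  have "(\<lambda>n. q n * (\<integral>x. Re (f x) \<partial>\<kappa> n)) sums (\<integral>x. Re (f x) \<partial>P)"
    "(\<lambda>n. q n * (\<integral>x. Im (f x) \<partial>\<kappa> n)) sums (\<integral>x. Im (f x) \<partial>P)"
    using real[of "\<lambda>x. Re (f x)"] real[of "\<lambda>x. Im (f x)"] by (auto simp: abs_Re_le_cmod abs_Im_le_cmod)
  then show "(\<lambda>n. complex_of_real (q n) * (\<integral>x. f x \<partial>\<kappa> n)) sums (\<integral>x. f x \<partial>P)"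
    by (simp add: sums_complex_iff int int_f)
qed

lemma kernel_det_0: "kernel_det K 0 x = 1"
  by (simp add: kernel_det_eq_leibniz_det leibniz_det_def)

locale grand_canonical = orthonormal_family M \<psi> for M :: "'a::metric_space measure" and \<psi> +
  fixes a :: "nat \<Rightarrow> real" and lam :: real and \<phi> :: "'a \<Rightarrow> 'a \<Rightarrow> complex"
  defines "\<phi> \<equiv> series_kernel a \<psi>"
  assumes sets_M: "sets M = sets borel"
    and a_nonneg: "a n \<ge> 0" and a_summable: "summable a"
    and partition_pos: "N \<ge> 1 \<Longrightarrow> partition_fn M \<phi> N > 0"
    and density_nonneg: "N \<ge> 1 \<Longrightarrow> AE x in power_measure M N. canonical_density M \<phi> N x \<ge> 0"
    and lam_pos: "lam > 0"
begin

definition real_partition_fn :: "nat \<Rightarrow> real" where "real_partition_fn N = Re (partition_fn M \<phi> N)"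

lemma real_partition_fn_pos: "real_partition_fn N > 0" and partition_fn_eq: "partition_fn M \<phi> N = complex_of_real (real_partition_fn N)"
proof -
  have "partition_fn M \<phi> N > 0"
    using partition_pos[of N] by (cases "N = 0") (auto simp: partition_fn_def less_complex_def)
  then show "real_partition_fn N > 0" "partition_fn M \<phi> N = complex_of_real (real_partition_fn N)"
    by (auto simp: real_partition_fn_def less_complex_def complex_eq_iff)
qed

lemma partition_fn_integral: "partition_fn M \<phi> N = (\<integral>x. kernel_det \<phi> N x \<partial>power_measure M N)"
  by (auto simp: partition_fn_def kernel_det_0 PiM_empty lebesgue_integral_count_space_finite)

lemma measurable_kernel_det_phi[measurable]: "kernel_det \<phi> N \<in> borel_measurable (power_measure M N)"
  unfolding \<phi>_def by measurable

lemma integrable_kernel_det_phi: "integrable (power_measure M N) (kernel_det \<phi> N)"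
  using integrable_kernel_det_series[of "\<lambda>_. 1" 1 a N] a_nonneg a_summable by (simp add: \<phi>_def)

definition position_density :: "nat \<Rightarrow> (nat \<Rightarrow> 'a) \<Rightarrow> real" where
  "position_density N x = Re (canonical_density M \<phi> N x)"

lemma measurable_position_density[measurable]:
  "position_density N \<in> borel_measurable (power_measure M N)"
  unfolding position_density_def[abs_def] canonical_density_def by measurable

lemma AE_position_density:
  "AE x in power_measure M N. 0 \<le> position_density N x \<and>
    complex_of_real (position_density N x) = kernel_det \<phi> N x / complex_of_real (real_partition_fn N)"
proof -
  have "AE x in power_measure M N. canonical_density M \<phi> N x \<ge> 0"
    using density_nonneg[of N]
    by (cases "N = 0") (auto simp: canonical_density_def partition_fn_def kernel_det_0 less_eq_complex_def)
  then show ?thesis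
    by eventually_elim
      (auto simp: position_density_def less_eq_complex_def complex_eq_iff canonical_density_def partition_fn_eq)
qed

lemma prob_space_position_density:
  "prob_space (density (power_measure M N) (\<lambda>x. ennreal (position_density N x)))"
proof
  have "(\<integral>x. position_density N x \<partial>power_measure M N) = Re (\<integral>x. canonical_density M \<phi> N x \<partial>power_measure M N)"
    unfolding position_density_def canonical_density_def
    by (intro integral_Re integrable_mult_right integrable_kernel_det_phi)
  also have "\<dots> = 1"
    using real_partition_fn_pos[of N] by (simp add: canonical_density_def partition_fn_integral[symmetric] partition_fn_eq)
  finally have 1: "(\<integral>x. position_density N x \<partial>power_measure M N) = 1" .
  have "integrable (power_measure M N) (position_density N)"
    unfolding position_density_def[abs_def] canonical_density_def
    by (intro integrable_Re integrable_mult_right integrable_kernel_det_phi)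
  then have "(\<integral>\<^sup>+x. ennreal (position_density N x) \<partial>power_measure M N) = ennreal 1"
    unfolding 1[symmetric] using AE_position_density[of N]
    by (intro nn_integral_eq_integral) auto
  then show "emeasure (density (power_measure M N) (\<lambda>x. ennreal (position_density N x)))
      (space (density (power_measure M N) (\<lambda>x. ennreal (position_density N x)))) = 1"
    by (simp add: emeasure_density cong: nn_integral_cong)
qed

lemma canonical_process_eq:
  "canonical_process M \<phi> N =
    distr (density (power_measure M N) (\<lambda>x. ennreal (position_density N x))) config_space (config_of N)"
  by (simp add: canonical_process_def position_density_def)

lemma measurable_config_of_density:
  "config_of N \<in> measurable (density (power_measure M N) (\<lambda>x. ennreal (position_density N x))) config_space"
  using measurable_config_of[OF sets_M] by simp

lemma prob_space_canonical_process: "prob_space (canonical_process M \<phi> N)"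
  unfolding canonical_process_eq
  by (rule prob_space.prob_space_distr[OF prob_space_position_density measurable_config_of_density])

lemma sets_canonical_process: "sets (canonical_process M \<phi> N) = sets config_space"
  by (simp add: canonical_process_def)

context
  fixes g :: "'a \<Rightarrow> complex" and C :: real
  assumes g: "g \<in> borel_measurable borel" and gC: "\<And>x. cmod (g x) \<le> C"
    and supp: "bounded {x. g x \<noteq> 0}"
begin

lemma g_measurable[measurable]: "g \<in> borel_measurable M"
  using g by (simp add: measurable_cong_sets[OF sets_M refl])

lemma norm_one_plus_le: "cmod (1 + g x) \<le> 1 + C"
  using norm_triangle_ineq[of 1 "g x"] gC[of x] by simp

lemma norm_prod_one_plus_le: "cmod (\<Prod>j<N. 1 + g (x j)) \<le> (1 + C) ^ N"
proof -
  have "cmod (\<Prod>j<N. 1 + g (x j)) \<le> (\<Prod>j<N. 1 + C)"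
    unfolding prod_norm[symmetric] by (intro prod_mono) (auto simp: norm_one_plus_le)
  then show ?thesis by simp
qed

lemma measurable_prod_one_plus:
  "(\<lambda>x. \<Prod>j<N. 1 + g (x j)) \<in> borel_measurable (power_measure M N)"
  by (intro borel_measurable_prod measurable_coordinate[where f = "\<lambda>x. 1 + g x"]) auto

lemma
  shows integrable_canonical_process: "integrable (canonical_process M \<phi> N) (particle_prod g)"
    and integral_canonical_process:
      "(\<integral>c. particle_prod g c \<partial>canonical_process M \<phi> N) =
        (\<integral>x. (\<Prod>j<N. 1 + g (x j)) * kernel_det \<phi> N x \<partial>power_measure M N) / complex_of_real (real_partition_fn N)"
    and integral_norm_canonical_process_le:
      "(\<integral>c. norm (particle_prod g c) \<partial>canonical_process M \<phi> N) \<le> (1 + C) ^ N"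
proof -
  let ?Q = "density (power_measure M N) (\<lambda>x. ennreal (position_density N x))"
  interpret Q: prob_space ?Q by (rule prob_space_position_density)
  note meas = measurable_particle_prod[OF g supp]
  have meas_Q: "(\<lambda>x. \<Prod>j<N. 1 + g (x j)) \<in> borel_measurable ?Q"
    using measurable_prod_one_plus by simp
  have int_Q: "integrable ?Q (\<lambda>x. \<Prod>j<N. 1 + g (x j))"
    by (rule Q.integrable_const_bound[OF _ meas_Q]) (use norm_prod_one_plus_le in auto)
  show "integrable (canonical_process M \<phi> N) (particle_prod g)"
    unfolding canonical_process_eq integrable_distr_eq[OF measurable_config_of_density meas]
    by (simp add: particle_prod_config_of int_Q)
  have "(\<integral>c. norm (particle_prod g c) \<partial>canonical_process M \<phi> N) = (\<integral>x. norm (\<Prod>j<N. 1 + g (x j)) \<partial>?Q)"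
    unfolding canonical_process_eq
    by (subst integral_distr[OF measurable_config_of_density]) (use measurable_compose[OF meas borel_measurable_norm] in \<open>simp_all add: particle_prod_config_of\<close>)
  also have "\<dots> \<le> (1 + C) ^ N"
    by (rule Q.integral_le_const) (use int_Q norm_prod_one_plus_le in auto)
  finally show "(\<integral>c. norm (particle_prod g c) \<partial>canonical_process M \<phi> N) \<le> (1 + C) ^ N" .
  have "(\<integral>c. particle_prod g c \<partial>canonical_process M \<phi> N) = (\<integral>x. (\<Prod>j<N. 1 + g (x j)) \<partial>?Q)"
    unfolding canonical_process_eq
    by (subst integral_distr[OF measurable_config_of_density meas]) (simp add: particle_prod_config_of)
  also have "\<dots> = (\<integral>x. position_density N x *\<^sub>R (\<Prod>j<N. 1 + g (x j)) \<partial>power_measure M N)"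
    using AE_position_density[of N] by (intro integral_density measurable_prod_one_plus) auto
  also have "\<dots> = (\<integral>x. ((\<Prod>j<N. 1 + g (x j)) * kernel_det \<phi> N x) / complex_of_real (real_partition_fn N) \<partial>power_measure M N)"
  proof (rule integral_cong_AE)
    show "AE x in power_measure M N. position_density N x *\<^sub>R (\<Prod>j<N. 1 + g (x j)) =
        ((\<Prod>j<N. 1 + g (x j)) * kernel_det \<phi> N x) / complex_of_real (real_partition_fn N)"
      using AE_position_density[of N] by eventually_elim (simp add: scaleR_conv_of_real)
  qed (use measurable_prod_one_plus in measurable)
  finally show "(\<integral>c. particle_prod g c \<partial>canonical_process M \<phi> N) =
        (\<integral>x. (\<Prod>j<N. 1 + g (x j)) * kernel_det \<phi> N x \<partial>power_measure M N) / complex_of_real (real_partition_fn N)"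
    by simp
qed

end

definition grand_weight :: "nat \<Rightarrow> real" where "grand_weight N = lam ^ N / fact N * real_partition_fn N"

lemma summable_grand_weight_power:
  assumes "r \<ge> 0"
  shows "summable (\<lambda>N. grand_weight N * r ^ N)"
proof -
  have "norm (1 / fact N * (\<integral>x. (\<Prod>j<N. complex_of_real (lam * r)) * kernel_det \<phi> N x \<partial>power_measure M N)) =
      grand_weight N * r ^ N" for N
    using real_partition_fn_pos[of N] lam_pos assms
    by (simp add: partition_fn_integral[symmetric] partition_fn_eq norm_mult norm_divide norm_power
        grand_weight_def power_mult_distrib)
  moreover have "summable (\<lambda>N. norm (1 / fact N *
      (\<integral>x. (\<Prod>j<N. complex_of_real (lam * r)) * kernel_det \<phi> N x \<partial>power_measure M N)))"
    unfolding \<phi>_def using lam_pos assms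
    by (intro summable_fredholm[where C = "lam * r"] a_nonneg a_summable)
      (auto simp del: of_real_mult)
  ultimately show ?thesis by (simp only:)
qed

lemma summable_grand_weight: "summable grand_weight"
  using summable_grand_weight_power[of 1] by simp

lemma grand_weight_pos: "grand_weight N > 0"
  using real_partition_fn_pos[of N] lam_pos by (simp add: grand_weight_def)

lemma suminf_grand_weight_pos: "suminf grand_weight > 0"
  by (rule suminf_pos[OF summable_grand_weight grand_weight_pos])

lemma grand_partition_fn_eq: "grand_partition_fn M \<phi> lam = complex_of_real (suminf grand_weight)"
  unfolding grand_partition_fn_def partition_fn_eq suminf_of_real[OF summable_grand_weight]
  by (simp add: grand_weight_def)

lemma number_prob_eq: "number_prob M \<phi> lam N = complex_of_real (grand_weight N / suminf grand_weight)"
  by (simp add: number_prob_def grand_partition_fn_eq partition_fn_eq grand_weight_def)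

lemma prob_space_number: "prob_space (density (count_space UNIV) (\<lambda>N. ennreal (grand_weight N / suminf grand_weight)))"
proof
  have "(\<Sum>N. ennreal (grand_weight N / suminf grand_weight)) = ennreal (\<Sum>N. grand_weight N / suminf grand_weight)"
    using grand_weight_pos suminf_grand_weight_pos by (intro suminf_ennreal2 summable_divide summable_grand_weight) (auto intro: less_imp_le)
  also have "\<dots> = 1"
    using suminf_grand_weight_pos by (simp add: suminf_divide[OF summable_grand_weight])
  finally show "emeasure (density (count_space UNIV) (\<lambda>N. ennreal (grand_weight N / suminf grand_weight)))
      (space (density (count_space UNIV) (\<lambda>N. ennreal (grand_weight N / suminf grand_weight)))) = 1"
    by (simp add: emeasure_density nn_integral_count_space_nat)
qed

lemma grand_canonical_process_eq:
  "grand_canonical_process M \<phi> lam =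
    density (count_space UNIV) (\<lambda>N. ennreal (grand_weight N / suminf grand_weight)) \<bind> canonical_process M \<phi>"
  by (simp add: grand_canonical_process_def number_prob_eq)

lemma point_process_grand_canonical: "point_process (grand_canonical_process M \<phi> lam)"
proof -
  have "canonical_process M \<phi> \<in> measurable (density (count_space UNIV) (\<lambda>N. ennreal (grand_weight N / suminf grand_weight)))
      (subprob_algebra config_space)"
    using prob_space_canonical_process sets_canonical_process
    by (auto simp: measurable_def space_subprob_algebra prob_space_imp_subprob_space)
  then have "prob_space (grand_canonical_process M \<phi> lam)"
    unfolding grand_canonical_process_eq using prob_space_canonical_process
    by (intro prob_space.prob_space_bind[OF prob_space_number]) auto
  moreover have "sets (grand_canonical_process M \<phi> lam) = sets config_space"
    unfolding grand_canonical_process_eq by (rule sets_bind) (auto simp: sets_canonical_process)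
  ultimately show ?thesis by (simp add: point_process_def)
qed

lemma
  assumes g: "g \<in> borel_measurable borel" and gC: "\<And>x. cmod (g x) \<le> C"
    and supp: "bounded {x. g x \<noteq> 0}"
  defines "b \<equiv> \<lambda>n. lam * a n / (1 + lam * a n)"
  shows integrable_grand_canonical: "integrable (grand_canonical_process M \<phi> lam) (particle_prod g)"
    and integral_grand_canonical: "(\<integral>c. particle_prod g c \<partial>grand_canonical_process M \<phi> lam) =
      (\<Sum>k. 1 / fact k * (\<integral>x. (\<Prod>j<k. g (x j)) * kernel_det (series_kernel b \<psi>) k x \<partial>power_measure M k))"
proof -
  let ?\<kappa> = "canonical_process M \<phi>" and ?q = "\<lambda>N. grand_weight N / suminf grand_weight" and ?P = "grand_canonical_process M \<phi> lam"
  let ?T = "\<lambda>h N. 1 / fact N * (\<integral>x. (\<Prod>j<N. h (x j)) * kernel_det \<phi> N x \<partial>power_measure M N)"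
  have C: "C \<ge> 0" using order_trans[OF norm_ge_zero gC] .
  have gM: "g \<in> borel_measurable M" by (rule g_measurable[OF g gC supp])
  have q: "0 \<le> ?q N" for N
    using grand_weight_pos[of N] suminf_grand_weight_pos by simp
  have sm: "summable (\<lambda>N. ?q N * (\<integral>c. norm (particle_prod g c) \<partial>?\<kappa> N))"
  proof (rule summable_comparison_test'[OF summable_divide[OF summable_grand_weight_power, of "1 + C" "suminf grand_weight"]])
    show "0 \<le> 1 + C" using C by simp
    fix N
    have "?q N * (\<integral>c. norm (particle_prod g c) \<partial>?\<kappa> N) \<le> ?q N * (1 + C) ^ N"
      by (intro mult_left_mono integral_norm_canonical_process_le[OF g gC supp] q)
    moreover have "0 \<le> ?q N * (\<integral>c. norm (particle_prod g c) \<partial>?\<kappa> N)"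
      by (intro mult_nonneg_nonneg q) simp
    ultimately show "norm (?q N * (\<integral>c. norm (particle_prod g c) \<partial>?\<kappa> N)) \<le> grand_weight N * (1 + C) ^ N / suminf grand_weight"
      by (simp only: real_norm_def abs_of_nonneg times_divide_eq_left)
  qed
  note mix = integral_discrete_bind[OF prob_space_imp_subprob_space[OF prob_space_canonical_process]
      sets_canonical_process q measurable_particle_prod[OF g supp]
      integrable_canonical_process[OF g gC supp] sm, folded grand_canonical_process_eq]
  show "integrable ?P (particle_prod g)" by (rule mix)
  have term_eq: "complex_of_real (?q N) * (\<integral>c. particle_prod g c \<partial>?\<kappa> N) =
      ?T (\<lambda>x. complex_of_real lam * (1 + g x)) N / complex_of_real (suminf grand_weight)" for N
    using real_partition_fn_pos[of N]
    by (simp add: integral_canonical_process[OF g gC supp] grand_weight_def prod.distrib mult.assoc)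
  have "(\<Sum>N. ?T (\<lambda>x. complex_of_real lam * (1 + g x)) N) =
      (\<Sum>N. ?T (\<lambda>x. complex_of_real lam) N) *
      (\<Sum>k. 1 / fact k * (\<integral>x. (\<Prod>j<k. g (x j)) * kernel_det (series_kernel b \<psi>) k x \<partial>power_measure M k))"
    unfolding \<phi>_def b_def by (rule fredholm_factorization[OF gM gC a_nonneg a_summable lam_pos])
  also have "(\<Sum>N. ?T (\<lambda>x. complex_of_real lam) N) = complex_of_real (suminf grand_weight)"
    unfolding suminf_of_real[OF summable_grand_weight]
    by (simp add: partition_fn_integral[symmetric] partition_fn_eq grand_weight_def)
  finally have fact: "(\<Sum>N. ?T (\<lambda>x. complex_of_real lam * (1 + g x)) N) / complex_of_real (suminf grand_weight) =
      (\<Sum>k. 1 / fact k * (\<integral>x. (\<Prod>j<k. g (x j)) * kernel_det (series_kernel b \<psi>) k x \<partial>power_measure M k))"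
    using suminf_grand_weight_pos by simp
  have bound: "cmod (complex_of_real lam * (1 + g x)) \<le> lam * (1 + C)" for x
    using lam_pos norm_one_plus_le[OF g gC supp, of x] by (simp add: norm_mult)
  have meas: "(\<lambda>x. complex_of_real lam * (1 + g x)) \<in> borel_measurable M"
    using gM by measurable
  have "summable (?T (\<lambda>x. complex_of_real lam * (1 + g x)))"
    unfolding \<phi>_def
    by (rule summable_norm_cancel[OF summable_fredholm[OF meas bound a_nonneg a_summable]])
  from sums_divide[OF summable_sums[OF this], of "complex_of_real (suminf grand_weight)"]
  show "(\<integral>c. particle_prod g c \<partial>?P) =
      (\<Sum>k. 1 / fact k * (\<integral>x. (\<Prod>j<k. g (x j)) * kernel_det (series_kernel b \<psi>) k x \<partial>power_measure M k))"
    using mix(2) unfolding term_eq fact by (rule sums_unique2[symmetric])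
qed

lemma determinantal_grand_canonical:
  "determinantal_process M (series_kernel (\<lambda>n. lam * a n / (1 + lam * a n)) \<psi>)
    (grand_canonical_process M \<phi> lam)"
  unfolding determinantal_process_def
proof (intro conjI ballI impI allI; (elim conjE)?)
  show "point_process (grand_canonical_process M \<phi> lam)" by (rule point_process_grand_canonical)
next
  let ?K = "series_kernel (\<lambda>n. lam * a n / (1 + lam * a n)) \<psi>"
  fix g :: "'a \<Rightarrow> complex"
  assume g: "g \<in> borel_measurable borel" and bd: "bounded (range g)" and supp: "bounded {x. g x \<noteq> 0}"
  obtain C where gC: "\<And>x. cmod (g x) \<le> C" using bd by (auto simp: bounded_iff)
  have gM: "g \<in> borel_measurable M" by (rule g_measurable[OF g gC supp])
  note b = fermi_weight[OF a_nonneg a_summable lam_pos]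
  show "integrable (grand_canonical_process M \<phi> lam) (particle_prod g)"
    by (rule integrable_grand_canonical[OF g gC supp])
  show "integrable (power_measure M k) (\<lambda>x. (\<Prod>j<k. g (x j)) * kernel_det ?K k x)" for k
    by (rule integrable_kernel_det_series[OF gM gC b])
  show "(\<lambda>k. 1 / fact k * (\<integral>x. (\<Prod>j<k. g (x j)) * kernel_det ?K k x \<partial>power_measure M k)) sums
      (\<integral>c. particle_prod g c \<partial>grand_canonical_process M \<phi> lam)"
    unfolding integral_grand_canonical[OF g gC supp]
    by (intro summable_sums summable_norm_cancel[OF summable_fredholm[OF gM gC b]])
qed

end

theorem theorem1p5:
  fixes M :: "'a::polish_space measure"
    and \<psi> :: "nat \<Rightarrow> 'a \<Rightarrow> complex"
    and a :: "nat \<Rightarrow> real"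
    and lam :: real
  defines "\<phi> \<equiv> series_kernel a \<psi>"
  assumes "sets M = sets borel"
    and "sigma_finite_measure M"
    and "orthonormal_L2 M \<psi>"
    and "\<And>n. a n \<ge> 0"
    and "summable a"
    and "\<And>N. N \<ge> 1 \<Longrightarrow> partition_fn M \<phi> N > 0"
    and "\<And>N. N \<ge> 1 \<Longrightarrow> AE x in power_measure M N. canonical_density M \<phi> N x \<ge> 0"
    and "lam > 0"
  shows "determinantal_process M
           (series_kernel (\<lambda>n. lam * a n / (1 + lam * a n)) \<psi>)
           (grand_canonical_process M \<phi> lam)"
proof -
  interpret sigma_finite_measure M by fact
  interpret grand_canonical M \<psi> a lam \<phi>
    using assms by unfold_locales (auto simp: \<phi>_def)
  show ?thesis by (rule determinantal_grand_canonical)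
qed

end
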